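(* Let $(R,\mathfrak m)$ be a complete (Noetherian) local ring. (1) Let $\mathcal M,\mathcal P,\mathcal P'$ be a projective setting (as defined in the context) in which, additionally, all modules are finitely generated. If $p$ is a cofunctorial pair operation defined on $\mathcal P$ and $p_{\mathrm c}$ is its cohereditary version on $\mathcal P'$, then $(p_{\mathrm c})^{\smile}=(p^{\smile})_{\mathrm h}$ is the hereditary version of $p^{\smile}$ defined on $(\mathcal P')^\vee$. In particular, if $\mathrm{cl}$ is a cofunctorial (hence functorial) closure operation defined on $\mathcal P$ and $\mathrm{cl}_{\mathrm r}$ is the residual version of $\mathrm{cl}$ on $\mathcal P'$, then $(\mathrm{cl}_{\mathrm r})^{\smile}=(\mathrm{cl}^{\smile})_{\mathrm a}$ is the absolute version of the interior operation $\mathrm{cl}^{\smile}$. (2) Let $\mathcal M,\mathcal P,\mathcal P'$ be an injective setting (as defined in the context) in which, additionally, all modules are Artinian. If $p$ is a functorial pair operation defined on $\mathcal P$ and $p_{\mathrm h}$ is its hereditary version on $\mathcal P'$, then $(p_{\mathrm h})^{\smile}=(p^{\smile})_{\mathrm c}$ is the cohereditary version of $p^{\smile}$ defined on $(\mathcal P')^\vee$. In particular, if $\mathrm i$ is a functorial interior operation defined on $\mathcal P$ and $\mathrm i_{\mathrm a}$ is the absolute version of $\mathrm i$ on $\mathcal P'$, then $(\mathrm i_{\mathrm a})^{\smile}=(\mathrm i^{\smile})_{\mathrm r}$ is the residual version of the closure operation $\mathrm i^{\smile}$.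
   Context: Throughout, $\mathcal M$ is an abelian category of $R$-modules and $R$-linear maps, with the usual inclusions, quotients, kernels and images; homomorphisms are morphisms of $\mathcal M$, and projective/injective mean projective/injective in $\mathcal M$. Classes of pairs $(L,M)$, $L\subseteq M$ in $\mathcal M$, are closed under isomorphism ($(\phi(L),M')$ belongs if $(L,M)$ does and $\phi:M\to M'$ is an isomorphism). A pair operation $p$ on such a class sends $(L,M)$ to a submodule $p(L,M)\subseteq M$ with $\phi(p(L,M))=p(\phi(L),M')$ for isomorphisms $\phi:M\to M'$. It is functorial if $g(p(L,M))\subseteq p(g(L),M')$, and cofunctorial if $p(g^{-1}(L'),M)\subseteq g^{-1}(p(L',M'))$, for all $g:M\to M'$ for which the pairs involved lie in the class. It is a closure (resp. interior) operation if it is order-preserving on submodules ($L\subseteq N\subseteq M$ implies $p(L,M)\subseteq p(N,M)$), idempotent ($p(p(L,M),M)=p(L,M)$ when this is defined), and satisfies $L\subseteq p(L,M)$ (resp. $p(L,M)\subseteq L$). Projective setting: $\mathcal M$ has enough projectives; $\mathcal P$ is a set of pairs $(N,P)$ with $P$ projective; $\mathcal P'\supseteq\mathcal P$ is a set of pairs such that (i) for every $(L,M)\in\mathcal P'$ there is a surjection $\pi:P\to M$ in $\mathcal M$, $P$ projective, with $(\pi^{-1}(L),P)\in\mathcal P$; (ii) if $(L,M),(N,M)\in\mathcal P'$, $L\subseteq N$, there is one such $\pi$ with both $(\pi^{-1}(L),P),(\pi^{-1}(N),P)\in\mathcal P$; (iii) given $L,M,P,\pi$ as in (i), a surjection $\phi:M\to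 N$, a surjection $q:Q\to N$ with $Q$ projective and $(q^{-1}(\phi(L)),Q)\in\mathcal P$, and any $\tilde\phi:P\to Q$ with $\phi\pi=q\tilde\phi$, we have $(\tilde\phi(\pi^{-1}(L)),Q)\in\mathcal P$. For cofunctorial $p$ on $\mathcal P$, the cohereditary version on $\mathcal P'$ is $p_{\mathrm c}(L,M)=\pi(p(\pi^{-1}(L),P))$ for any $\pi$ as in (i) (independent of choice). When $p$ is extensive ($L\subseteq p(L,M)$), e.g. a closure, $p_{\mathrm c}$ is written $p_{\mathrm r}$ and called the residual version. Injective setting: $\mathcal M$ has enough injectives; $\mathcal P$ is a set of pairs $(C,E)$ with $E$ injective; $\mathcal P'\supseteq\mathcal P$ is a set of pairs such that (i) for every $(A,B)\in\mathcal P'$ there is an injection $i:B\to E$ in $\mathcal M$, $E$ injective, with $(i(A),E)\in\mathcal P$; (ii) if $(A,B),(C,B)\in\mathcal P'$, $A\subseteq C$, there is one such $i$ with both $(i(A),E),(i(C),E)\in\mathcal P$; (iii) given $A,B,E,i$ as in (i), an injection $\psi:B\to C$, an injection $j:C\to F$ with $F$ injective and $(j(\psi(A)),F)\in\mathcal P$, and any $\tilde\psi:E\to F$ with $\tilde\psi i=j\psi$, we have $(\tilde\psi^{-1}(j(\psi(A))),E)\in\mathcal P$. For functorial $p$ on $\mathcal P$, the hereditary version on $\mathcal P'$ is $p_{\mathrm h}(A,B)=i^{-1}(p(i(A),E))$ for any $i$ as in (i) (independent of choice). When $p$ is intensive ($p(L,M)\subseteq L$), e.g. an interior, $p_{\mathrm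 h}$ is written $p_{\mathrm a}$ and called the absolute version. Duality: ${}^\vee$ is Matlis duality. For a class $\mathcal Q$ of pairs, $\mathcal Q^\vee:=\{(A,B)\mid((B/A)^\vee,B^\vee)\in\mathcal Q\}$, with $(B/A)^\vee\subseteq B^\vee$ via the dual of $B\twoheadrightarrow B/A$, and for a pair operation $p$ on $\mathcal Q$, $p^{\smile}(A,B):=\big(B^\vee/p((B/A)^\vee,B^\vee)\big)^\vee\subseteq B^{\vee\vee}\cong B$ on $\mathcal Q^\vee$. The Matlis dual of a projective (resp. injective) setting with all modules finitely generated (resp. Artinian), i.e. $\mathcal P^\vee,(\mathcal P')^\vee$ in the category of the modules $M^\vee$ and maps $f^\vee$ with $M,f$ in $\mathcal M$, is an injective (resp. projective) setting; the hereditary/cohereditary versions of $p^{\smile}$ are taken in this dual setting. *)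

theory Defs
  imports "HOL-Algebra.Ideal_Product" "HOL-Algebra.Module" "HOL-Algebra.Ring_Divisibility"
begin

section \<open>Modules and linear maps\<close>

text \<open>A module is represented by a record \<open>('a, 'b) module\<close>, whose fields \<open>mult\<close> and \<open>one\<close> carry
  no meaning.  Linear maps are extensional, so that two of them are equal as HOL functions if and
  only if they agree on the carrier of their domain.\<close>

definition lin ::
  "('a, 'r) ring_scheme \<Rightarrow> ('a, 'b) module \<Rightarrow> ('a, 'c) module \<Rightarrow> ('b \<Rightarrow> 'c) set" where
  "lin R M N = {f \<in> carrier M \<rightarrow>\<^sub>E carrier N.
     (\<forall>x\<in>carrier M. \<forall>y\<in>carrier M. f (x \<oplus>\<^bsub>M\<^esub> y) = f x \<oplus>\<^bsub>N\<^esub> f y) \<and>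
     (\<forall>r\<in>carrier R. \<forall>x\<in>carrier M. f (r \<odot>\<^bsub>M\<^esub> x) = r \<odot>\<^bsub>N\<^esub> f x)}"

definition quot_module :: "('a, 'b) module \<Rightarrow> 'b set \<Rightarrow> ('a, 'b set) module" where
  "quot_module M L = \<lparr>carrier = a_rcosets\<^bsub>M\<^esub> L, monoid.mult = undefined, one = undefined, zero = L,
     add = set_add M, smult = (\<lambda>r X. \<Union>x\<in>X. L +>\<^bsub>M\<^esub> (r \<odot>\<^bsub>M\<^esub> x))\<rparr>"

definition quot_map :: "('a, 'b) module \<Rightarrow> 'b set \<Rightarrow> 'b \<Rightarrow> 'b set" where
  "quot_map M L = (\<lambda>x\<in>carrier M. L +>\<^bsub>M\<^esub> x)"

definition regular_module :: "('a, 'r) ring_scheme \<Rightarrow> ('a, 'a) module" where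
  "regular_module R = \<lparr>carrier = carrier R, monoid.mult = undefined, one = undefined, zero = \<zero>\<^bsub>R\<^esub>,
     add = add R, smult = monoid.mult R\<rparr>"

definition finitely_generated_module :: "('a, 'r) ring_scheme \<Rightarrow> ('a, 'b) module \<Rightarrow> bool" where
  "finitely_generated_module R M \<longleftrightarrow>
     (\<exists>S. finite S \<and> S \<subseteq> carrier M \<and> \<Inter>{H. submodule H R M \<and> S \<subseteq> H} = carrier M)"

definition artinian_module :: "('a, 'r) ring_scheme \<Rightarrow> ('a, 'b) module \<Rightarrow> bool" where
  "artinian_module R M \<longleftrightarrow>
     (\<forall>H :: nat \<Rightarrow> 'b set. (\<forall>n. submodule (H n) R M \<and> H (Suc n) \<subseteq> H n) \<longrightarrow>
        (\<exists>N. \<forall>n\<ge>N. H n = H N))"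

text \<open>In HOL the test modules of a definition of injectivity have to live in one fixed type.
  Taking the type of the ring elements includes the inclusions of all ideals into the ring, so by
  Baer's criterion the condition does not depend on this choice of universe.\<close>

definition injective_module :: "('a, 'r) ring_scheme \<Rightarrow> ('a, 'e) module \<Rightarrow> bool" where
  "injective_module R E \<longleftrightarrow> module R E \<and>
     (\<forall>(M :: ('a, 'a) module) (N :: ('a, 'a) module) i f.
        module R M \<and> module R N \<and> i \<in> lin R M N \<and> inj_on i (carrier M) \<and> f \<in> lin R M E \<longrightarrow>
        (\<exists>g\<in>lin R N E. \<forall>x\<in>carrier M. g (i x) = f x))"

definition injective_hull ::
  "('a, 'r) ring_scheme \<Rightarrow> ('a, 'b) module \<Rightarrow> ('a, 'e) module \<Rightarrow> bool" where
  "injective_hull R K E \<longleftrightarrow> injective_module R E \<and>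
     (\<exists>\<iota>\<in>lin R K E. inj_on \<iota> (carrier K) \<and>
        (\<forall>H. submodule H R E \<and> H \<noteq> {\<zero>\<^bsub>E\<^esub>} \<longrightarrow> H \<inter> \<iota> ` carrier K \<noteq> {\<zero>\<^bsub>E\<^esub>}))"


section \<open>Complete Noetherian local rings\<close>

locale complete_local_ring = cring R + noetherian_ring R for R :: "('a, 'r) ring_scheme" (structure) +
  fixes \<mm> :: "'a set"
  assumes maximal: "maximalideal \<mm> R"
    and local: "maximalideal J R \<Longrightarrow> J = \<mm>"
    and separated: "(\<Inter>n::nat. \<mm> [^]\<^bsub>ideals_set R\<^esub> n) = {\<zero>}"
    and complete:
      "\<lbrakk>range x \<subseteq> carrier R;
        \<forall>n::nat. \<exists>N. \<forall>i\<ge>N. \<forall>j\<ge>N. x i \<ominus> x j \<in> \<mm> [^]\<^bsub>ideals_set R\<^esub> n\<rbrakk> \<Longrightarrow>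
       \<exists>y\<in>carrier R. \<forall>n::nat. \<exists>N. \<forall>i\<ge>N. x (i::nat) \<ominus> y \<in> \<mm> [^]\<^bsub>ideals_set R\<^esub> n"

definition residue_field :: "('a, 'r) ring_scheme \<Rightarrow> 'a set \<Rightarrow> ('a, 'a set) module" where
  "residue_field R \<mm> = quot_module (regular_module R) \<mm>"


section \<open>Abelian categories of modules\<close>

text \<open>A (not necessarily full) category of modules consists of a set of objects, each with an
  underlying module, and sets of linear maps between the underlying modules.  The case of
  a set of modules is \<open>Und = id\<close>.  Keeping objects apart from their underlying
  modules makes it possible to form the category of the duals \<open>M\<^sup>\<or>\<close>: since HOL is a logic of total
  functions, different modules may have duals which are equal as records.\<close>

record ('a, 'b, 'o) modcat =
  Obj :: "'o set"
  Und :: "'o \<Rightarrow> ('a, 'b) module"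
  Mor :: "'o \<Rightarrow> 'o \<Rightarrow> ('b \<Rightarrow> 'b) set"

abbreviation elts :: "('a, 'b, 'o) modcat \<Rightarrow> 'o \<Rightarrow> 'b set" where
  "elts \<C> X \<equiv> carrier (Und \<C> X)"

abbreviation null :: "('a, 'b, 'o) modcat \<Rightarrow> 'o \<Rightarrow> 'b" where
  "null \<C> X \<equiv> \<zero>\<^bsub>Und \<C> X\<^esub>"

definition inj_mor :: "('a, 'b, 'o) modcat \<Rightarrow> 'o \<Rightarrow> 'o \<Rightarrow> ('b \<Rightarrow> 'b) \<Rightarrow> bool" where
  "inj_mor \<C> X Y f \<longleftrightarrow> X \<in> Obj \<C> \<and> Y \<in> Obj \<C> \<and> f \<in> Mor \<C> X Y \<and> inj_on f (elts \<C> X)"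

definition surj_mor :: "('a, 'b, 'o) modcat \<Rightarrow> 'o \<Rightarrow> 'o \<Rightarrow> ('b \<Rightarrow> 'b) \<Rightarrow> bool" where
  "surj_mor \<C> X Y f \<longleftrightarrow> X \<in> Obj \<C> \<and> Y \<in> Obj \<C> \<and> f \<in> Mor \<C> X Y \<and> f ` elts \<C> X = elts \<C> Y"

definition iso_mor :: "('a, 'b, 'o) modcat \<Rightarrow> 'o \<Rightarrow> 'o \<Rightarrow> ('b \<Rightarrow> 'b) \<Rightarrow> bool" where
  "iso_mor \<C> X Y f \<longleftrightarrow> X \<in> Obj \<C> \<and> Y \<in> Obj \<C> \<and> f \<in> Mor \<C> X Y \<and>
     (\<exists>g\<in>Mor \<C> Y X. (\<forall>x\<in>elts \<C> X. g (f x) = x) \<and> (\<forall>y\<in>elts \<C> Y. f (g y) = y))"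

text \<open>\<open>k : K \<rightarrow> X\<close> is a kernel of \<open>f : X \<rightarrow> Y\<close> in the category, and it is the usual one:
  an injection with image \<open>{x. f x = 0}\<close>; dually for cokernels.\<close>

definition is_kernel ::
  "('a, 'b, 'o) modcat \<Rightarrow> 'o \<Rightarrow> ('b \<Rightarrow> 'b) \<Rightarrow> 'o \<Rightarrow> 'o \<Rightarrow> ('b \<Rightarrow> 'b) \<Rightarrow> bool" where
  "is_kernel \<C> K k X Y f \<longleftrightarrow> inj_mor \<C> K X k \<and>
     k ` elts \<C> K = {x \<in> elts \<C> X. f x = null \<C> Y} \<and>
     (\<forall>W\<in>Obj \<C>. \<forall>g\<in>Mor \<C> W X. (\<forall>w\<in>elts \<C> W. f (g w) = null \<C> Y) \<longrightarrow>
        (\<exists>h\<in>Mor \<C> W K. \<forall>w\<in>elts \<C> W. g w = k (h w)))"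

definition is_cokernel ::
  "('a, 'b, 'o) modcat \<Rightarrow> 'o \<Rightarrow> ('b \<Rightarrow> 'b) \<Rightarrow> 'o \<Rightarrow> 'o \<Rightarrow> ('b \<Rightarrow> 'b) \<Rightarrow> bool" where
  "is_cokernel \<C> Q q X Y f \<longleftrightarrow> surj_mor \<C> Y Q q \<and>
     {y \<in> elts \<C> Y. q y = null \<C> Q} = f ` elts \<C> X \<and>
     (\<forall>W\<in>Obj \<C>. \<forall>g\<in>Mor \<C> Y W. (\<forall>x\<in>elts \<C> X. g (f x) = null \<C> W) \<longrightarrow>
        (\<exists>h\<in>Mor \<C> Q W. \<forall>y\<in>elts \<C> Y. g y = h (q y)))"

text \<open>As kernels are the usual ones, the monomorphisms are exactly the injective morphisms;
  likewise, the epimorphisms are exactly the surjective morphisms.\<close>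

locale abelian_modcat = cring R
  for R :: "('a, 'r) ring_scheme" (structure) and \<C> :: "('a, 'b, 'o) modcat" +
  assumes Und_module: "X \<in> Obj \<C> \<Longrightarrow> module R (Und \<C> X)"
    and Mor_lin: "\<lbrakk>X \<in> Obj \<C>; Y \<in> Obj \<C>\<rbrakk> \<Longrightarrow> Mor \<C> X Y \<subseteq> lin R (Und \<C> X) (Und \<C> Y)"
    and Mor_id: "X \<in> Obj \<C> \<Longrightarrow> (\<lambda>x\<in>elts \<C> X. x) \<in> Mor \<C> X X"
    and Mor_comp:
      "\<lbrakk>X \<in> Obj \<C>; Y \<in> Obj \<C>; Z \<in> Obj \<C>; f \<in> Mor \<C> X Y; g \<in> Mor \<C> Y Z\<rbrakk> \<Longrightarrow>
       compose (elts \<C> X) g f \<in> Mor \<C> X Z"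
    and Mor_zero: "\<lbrakk>X \<in> Obj \<C>; Y \<in> Obj \<C>\<rbrakk> \<Longrightarrow> (\<lambda>x\<in>elts \<C> X. null \<C> Y) \<in> Mor \<C> X Y"
    and Mor_diff:
      "\<lbrakk>X \<in> Obj \<C>; Y \<in> Obj \<C>; f \<in> Mor \<C> X Y; g \<in> Mor \<C> X Y\<rbrakk> \<Longrightarrow>
       (\<lambda>x\<in>elts \<C> X. f x \<ominus>\<^bsub>Und \<C> Y\<^esub> g x) \<in> Mor \<C> X Y"
    and zero_object: "\<exists>Z\<in>Obj \<C>. elts \<C> Z = {null \<C> Z}"
    and biproduct:
      "\<lbrakk>X \<in> Obj \<C>; Y \<in> Obj \<C>\<rbrakk> \<Longrightarrow>
       \<exists>S\<in>Obj \<C>. \<exists>i\<in>Mor \<C> X S. \<exists>j\<in>Mor \<C> Y S. \<exists>p\<in>Mor \<C> S X. \<exists>q\<in>Mor \<C> S Y.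
         (\<forall>x\<in>elts \<C> X. p (i x) = x \<and> q (i x) = null \<C> Y) \<and>
         (\<forall>y\<in>elts \<C> Y. p (j y) = null \<C> X \<and> q (j y) = y) \<and>
         (\<forall>s\<in>elts \<C> S. i (p s) \<oplus>\<^bsub>Und \<C> S\<^esub> j (q s) = s)"
    and kernels:
      "\<lbrakk>X \<in> Obj \<C>; Y \<in> Obj \<C>; f \<in> Mor \<C> X Y\<rbrakk> \<Longrightarrow> \<exists>K k. is_kernel \<C> K k X Y f"
    and cokernels:
      "\<lbrakk>X \<in> Obj \<C>; Y \<in> Obj \<C>; f \<in> Mor \<C> X Y\<rbrakk> \<Longrightarrow> \<exists>Q q. is_cokernel \<C> Q q X Y f"
    and monos_normal:
      "inj_mor \<C> K X k \<Longrightarrow> \<exists>Y\<in>Obj \<C>. \<exists>f\<in>Mor \<C> X Y. is_kernel \<C> K k X Y f"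
    and epis_normal:
      "surj_mor \<C> Y Q q \<Longrightarrow> \<exists>X\<in>Obj \<C>. \<exists>f\<in>Mor \<C> X Y. is_cokernel \<C> Q q X Y f"

definition projective_obj :: "('a, 'b, 'o) modcat \<Rightarrow> 'o \<Rightarrow> bool" where
  "projective_obj \<C> P \<longleftrightarrow> P \<in> Obj \<C> \<and>
     (\<forall>Y Z g f. surj_mor \<C> Y Z g \<and> f \<in> Mor \<C> P Z \<longrightarrow>
        (\<exists>h\<in>Mor \<C> P Y. \<forall>x\<in>elts \<C> P. g (h x) = f x))"

definition injective_obj :: "('a, 'b, 'o) modcat \<Rightarrow> 'o \<Rightarrow> bool" where
  "injective_obj \<C> I \<longleftrightarrow> I \<in> Obj \<C> \<and>
     (\<forall>Y Z g f. inj_mor \<C> Y Z g \<and> f \<in> Mor \<C> Y I \<longrightarrow>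
        (\<exists>h\<in>Mor \<C> Z I. \<forall>y\<in>elts \<C> Y. h (g y) = f y))"

definition enough_projectives :: "('a, 'b, 'o) modcat \<Rightarrow> bool" where
  "enough_projectives \<C> \<longleftrightarrow> (\<forall>X\<in>Obj \<C>. \<exists>P \<pi>. projective_obj \<C> P \<and> surj_mor \<C> P X \<pi>)"

definition enough_injectives :: "('a, 'b, 'o) modcat \<Rightarrow> bool" where
  "enough_injectives \<C> \<longleftrightarrow> (\<forall>X\<in>Obj \<C>. \<exists>I i. injective_obj \<C> I \<and> inj_mor \<C> X I i)"


section \<open>Pair operations\<close>

text \<open>A pair \<open>(L, X)\<close> consists of an object \<open>X\<close> and a subset \<open>L\<close> of its underlying module.
  That \<open>L \<subseteq> X\<close> holds in the category means that \<open>L\<close> is the image of a monomorphism.\<close>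

definition subobject :: "('a, 'b, 'o) modcat \<Rightarrow> 'o \<Rightarrow> 'b set \<Rightarrow> bool" where
  "subobject \<C> X L \<longleftrightarrow> (\<exists>K k. inj_mor \<C> K X k \<and> L = k ` elts \<C> K)"

definition pre :: "('a, 'b, 'o) modcat \<Rightarrow> 'o \<Rightarrow> ('b \<Rightarrow> 'b) \<Rightarrow> 'b set \<Rightarrow> 'b set" where
  "pre \<C> X f L = {x \<in> elts \<C> X. f x \<in> L}"

definition pair_class :: "('a, 'b, 'o) modcat \<Rightarrow> ('b set \<times> 'o) set \<Rightarrow> bool" where
  "pair_class \<C> \<Q> \<longleftrightarrow> (\<forall>(L, X)\<in>\<Q>. subobject \<C> X L \<and>
     (\<forall>Y \<phi>. iso_mor \<C> X Y \<phi> \<longrightarrow> (\<phi> ` L, Y) \<in> \<Q>))"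

type_synonym ('b, 'o) pair_op = "'b set \<Rightarrow> 'o \<Rightarrow> 'b set"

definition pair_operation ::
  "('a, 'r) ring_scheme \<Rightarrow> ('a, 'b, 'o) modcat \<Rightarrow> ('b set \<times> 'o) set \<Rightarrow> ('b, 'o) pair_op \<Rightarrow> bool"
  where
  "pair_operation R \<C> \<Q> p \<longleftrightarrow> (\<forall>(L, X)\<in>\<Q>. submodule (p L X) R (Und \<C> X) \<and>
     (\<forall>Y \<phi>. iso_mor \<C> X Y \<phi> \<longrightarrow> \<phi> ` p L X = p (\<phi> ` L) Y))"

definition functorial ::
  "('a, 'b, 'o) modcat \<Rightarrow> ('b set \<times> 'o) set \<Rightarrow> ('b, 'o) pair_op \<Rightarrow> bool" where
  "functorial \<C> \<Q> p \<longleftrightarrow> (\<forall>X\<in>Obj \<C>. \<forall>Y\<in>Obj \<C>. \<forall>g\<in>Mor \<C> X Y. \<forall>L.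
     (L, X) \<in> \<Q> \<and> (g ` L, Y) \<in> \<Q> \<longrightarrow> g ` p L X \<subseteq> p (g ` L) Y)"

definition cofunctorial ::
  "('a, 'b, 'o) modcat \<Rightarrow> ('b set \<times> 'o) set \<Rightarrow> ('b, 'o) pair_op \<Rightarrow> bool" where
  "cofunctorial \<C> \<Q> p \<longleftrightarrow> (\<forall>X\<in>Obj \<C>. \<forall>Y\<in>Obj \<C>. \<forall>g\<in>Mor \<C> X Y. \<forall>L.
     (pre \<C> X g L, X) \<in> \<Q> \<and> (L, Y) \<in> \<Q> \<longrightarrow> p (pre \<C> X g L) X \<subseteq> pre \<C> X g (p L Y))"

definition order_preserving :: "('b set \<times> 'o) set \<Rightarrow> ('b, 'o) pair_op \<Rightarrow> bool" where
  "order_preserving \<Q> p \<longleftrightarrow>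
     (\<forall>L N X. (L, X) \<in> \<Q> \<and> (N, X) \<in> \<Q> \<and> L \<subseteq> N \<longrightarrow> p L X \<subseteq> p N X)"

definition idempotent :: "('b set \<times> 'o) set \<Rightarrow> ('b, 'o) pair_op \<Rightarrow> bool" where
  "idempotent \<Q> p \<longleftrightarrow>
     (\<forall>L X. (L, X) \<in> \<Q> \<and> (p L X, X) \<in> \<Q> \<longrightarrow> p (p L X) X = p L X)"

definition closure_operation ::
  "('a, 'r) ring_scheme \<Rightarrow> ('a, 'b, 'o) modcat \<Rightarrow> ('b set \<times> 'o) set \<Rightarrow> ('b, 'o) pair_op \<Rightarrow> bool"
  where
  "closure_operation R \<C> \<Q> p \<longleftrightarrow> pair_operation R \<C> \<Q> p \<and> order_preserving \<Q> p \<and> idempotent \<Q> p \<and>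
     (\<forall>(L, X)\<in>\<Q>. L \<subseteq> p L X)"

definition interior_operation ::
  "('a, 'r) ring_scheme \<Rightarrow> ('a, 'b, 'o) modcat \<Rightarrow> ('b set \<times> 'o) set \<Rightarrow> ('b, 'o) pair_op \<Rightarrow> bool"
  where
  "interior_operation R \<C> \<Q> p \<longleftrightarrow> pair_operation R \<C> \<Q> p \<and> order_preserving \<Q> p \<and> idempotent \<Q> p \<and>
     (\<forall>(L, X)\<in>\<Q>. p L X \<subseteq> L)"


section \<open>Cohereditary and hereditary versions\<close>

definition projective_presentation ::
  "('a, 'b, 'o) modcat \<Rightarrow> ('b set \<times> 'o) set \<Rightarrow> 'b set \<Rightarrow> 'o \<Rightarrow> 'o \<Rightarrow> ('b \<Rightarrow> 'b) \<Rightarrow> bool" where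
  "projective_presentation \<C> \<P> L X P \<pi> \<longleftrightarrow>
     projective_obj \<C> P \<and> surj_mor \<C> P X \<pi> \<and> (pre \<C> P \<pi> L, P) \<in> \<P>"

definition injective_presentation ::
  "('a, 'b, 'o) modcat \<Rightarrow> ('b set \<times> 'o) set \<Rightarrow> 'b set \<Rightarrow> 'o \<Rightarrow> 'o \<Rightarrow> ('b \<Rightarrow> 'b) \<Rightarrow> bool" where
  "injective_presentation \<C> \<P> A B E i \<longleftrightarrow>
     injective_obj \<C> E \<and> inj_mor \<C> B E i \<and> (i ` A, E) \<in> \<P>"

locale projective_setting = abelian_modcat R \<C>
  for R :: "('a, 'r) ring_scheme" (structure) and \<C> :: "('a, 'b, 'o) modcat"
    and \<P> \<P>' :: "('b set \<times> 'o) set" +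
  assumes enough: "enough_projectives \<C>"
    and classes: "pair_class \<C> \<P>" "pair_class \<C> \<P>'"
    and projective: "(N, P) \<in> \<P> \<Longrightarrow> projective_obj \<C> P"
    and extends: "\<P> \<subseteq> \<P>'"
    and cover: "(L, M) \<in> \<P>' \<Longrightarrow> \<exists>P \<pi>. projective_presentation \<C> \<P> L M P \<pi>"
    and cover2:
      "\<lbrakk>(L, M) \<in> \<P>'; (N, M) \<in> \<P>'; L \<subseteq> N\<rbrakk> \<Longrightarrow>
       \<exists>P \<pi>. projective_presentation \<C> \<P> L M P \<pi> \<and> projective_presentation \<C> \<P> N M P \<pi>"
    and lift:
      "\<lbrakk>(L, M) \<in> \<P>'; projective_presentation \<C> \<P> L M P \<pi>; surj_mor \<C> M Y \<phi>;
        projective_presentation \<C> \<P> (\<phi> ` L) Y Q q; \<phi>' \<in> Mor \<C> P Q;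
        \<forall>x\<in>elts \<C> P. \<phi> (\<pi> x) = q (\<phi>' x)\<rbrakk> \<Longrightarrow>
       (\<phi>' ` pre \<C> P \<pi> L, Q) \<in> \<P>"

locale injective_setting = abelian_modcat R \<C>
  for R :: "('a, 'r) ring_scheme" (structure) and \<C> :: "('a, 'b, 'o) modcat"
    and \<P> \<P>' :: "('b set \<times> 'o) set" +
  assumes enough: "enough_injectives \<C>"
    and classes: "pair_class \<C> \<P>" "pair_class \<C> \<P>'"
    and injective: "(C, E) \<in> \<P> \<Longrightarrow> injective_obj \<C> E"
    and extends: "\<P> \<subseteq> \<P>'"
    and embed: "(A, B) \<in> \<P>' \<Longrightarrow> \<exists>E i. injective_presentation \<C> \<P> A B E i"
    and embed2:
      "\<lbrakk>(A, B) \<in> \<P>'; (C, B) \<in> \<P>'; A \<subseteq> C\<rbrakk> \<Longrightarrow>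
       \<exists>E i. injective_presentation \<C> \<P> A B E i \<and> injective_presentation \<C> \<P> C B E i"
    and extend:
      "\<lbrakk>(A, B) \<in> \<P>'; injective_presentation \<C> \<P> A B E i; inj_mor \<C> B Y \<psi>;
        injective_presentation \<C> \<P> (\<psi> ` A) Y F j; \<psi>' \<in> Mor \<C> E F;
        \<forall>x\<in>elts \<C> B. \<psi>' (i x) = j (\<psi> x)\<rbrakk> \<Longrightarrow>
       (pre \<C> E \<psi>' (j ` \<psi> ` A), E) \<in> \<P>"

definition cohereditary ::
  "('a, 'b, 'o) modcat \<Rightarrow> ('b set \<times> 'o) set \<Rightarrow> ('b, 'o) pair_op \<Rightarrow> ('b, 'o) pair_op" where
  "cohereditary \<C> \<P> p L X =
     (THE S. \<exists>P \<pi>. projective_presentation \<C> \<P> L X P \<pi> \<and> S = \<pi> ` p (pre \<C> P \<pi> L) P)"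

definition hereditary ::
  "('a, 'b, 'o) modcat \<Rightarrow> ('b set \<times> 'o) set \<Rightarrow> ('b, 'o) pair_op \<Rightarrow> ('b, 'o) pair_op" where
  "hereditary \<C> \<P> p A B =
     (THE S. \<exists>E i. injective_presentation \<C> \<P> A B E i \<and> S = pre \<C> B i (p (i ` A) E))"

text \<open>The names used when \<open>p\<close> is extensive, respectively intensive.\<close>

abbreviation (input) "residual \<equiv> cohereditary"
abbreviation (input) "absolute \<equiv> hereditary"

text \<open>The following predicates say that \<open>q\<close> is the version of \<open>p\<close> on \<open>\<P>'\<close>, including that
  presentations exist and that each of them computes \<open>q\<close>.\<close>

definition is_cohereditary_version ::
  "('a, 'b, 'o) modcat \<Rightarrow> ('b set \<times> 'o) set \<Rightarrow> ('b set \<times> 'o) set \<Rightarrow>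
   ('b, 'o) pair_op \<Rightarrow> ('b, 'o) pair_op \<Rightarrow> bool" where
  "is_cohereditary_version \<C> \<P> \<P>' p q \<longleftrightarrow> (\<forall>(L, X)\<in>\<P>'.
     (\<exists>P \<pi>. projective_presentation \<C> \<P> L X P \<pi>) \<and>
     (\<forall>P \<pi>. projective_presentation \<C> \<P> L X P \<pi> \<longrightarrow> q L X = \<pi> ` p (pre \<C> P \<pi> L) P))"

definition is_hereditary_version ::
  "('a, 'b, 'o) modcat \<Rightarrow> ('b set \<times> 'o) set \<Rightarrow> ('b set \<times> 'o) set \<Rightarrow>
   ('b, 'o) pair_op \<Rightarrow> ('b, 'o) pair_op \<Rightarrow> bool" where
  "is_hereditary_version \<C> \<P> \<P>' p q \<longleftrightarrow> (\<forall>(A, B)\<in>\<P>'.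
     (\<exists>E i. injective_presentation \<C> \<P> A B E i) \<and>
     (\<forall>E i. injective_presentation \<C> \<P> A B E i \<longrightarrow> q A B = pre \<C> B i (p (i ` A) E)))"

lemma cohereditary_le:
  assumes p: "cofunctorial \<C> \<P> p"
    and P: "projective_presentation \<C> \<P> L X P \<pi>" and Q: "projective_presentation \<C> \<P> L X Q \<rho>"
    and maps: "\<And>h. h \<in> Mor \<C> P Q \<Longrightarrow> h ` elts \<C> P \<subseteq> elts \<C> Q"
    and sub: "p (pre \<C> P \<pi> L) P \<subseteq> elts \<C> P"
  shows "\<pi> ` p (pre \<C> P \<pi> L) P \<subseteq> \<rho> ` p (pre \<C> Q \<rho> L) Q"
proof -
  have obj: "P \<in> Obj \<C>" "Q \<in> Obj \<C>"
    using P Q by (auto simp: projective_presentation_def projective_obj_def)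
  obtain h where h: "h \<in> Mor \<C> P Q" "\<forall>x\<in>elts \<C> P. \<rho> (h x) = \<pi> x"
    using P Q unfolding projective_presentation_def projective_obj_def surj_mor_def by meson
  have eq: "pre \<C> P h (pre \<C> Q \<rho> L) = pre \<C> P \<pi> L"
    using h maps[OF h(1)] by (auto simp: pre_def)
  have "p (pre \<C> P \<pi> L) P \<subseteq> pre \<C> P h (p (pre \<C> Q \<rho> L) Q)"
    using p P Q h(1) obj eq unfolding cofunctorial_def projective_presentation_def by metis
  then have "\<pi> x = \<rho> (h x) \<and> h x \<in> p (pre \<C> Q \<rho> L) Q" if "x \<in> p (pre \<C> P \<pi> L) P" for x
    using h(2) sub that unfolding pre_def by auto
  then show ?thesis by blast
qed

lemma hereditary_le:
  assumes p: "functorial \<C> \<P> p" and A: "A \<subseteq> elts \<C> B"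
    and E: "injective_presentation \<C> \<P> A B E i" and F: "injective_presentation \<C> \<P> A B F j"
  shows "pre \<C> B i (p (i ` A) E) \<subseteq> pre \<C> B j (p (j ` A) F)"
proof -
  have obj: "E \<in> Obj \<C>" "F \<in> Obj \<C>"
    using E F by (auto simp: injective_presentation_def injective_obj_def)
  obtain h where h: "h \<in> Mor \<C> E F" "\<forall>x\<in>elts \<C> B. h (i x) = j x"
    using E F unfolding injective_presentation_def injective_obj_def inj_mor_def by meson
  have eq: "h ` i ` A = j ` A"
    using h(2) A by force
  have "h ` p (i ` A) E \<subseteq> p (j ` A) F"
    using p E F h(1) obj eq unfolding functorial_def injective_presentation_def by metis
  then show ?thesis
    using h(2) unfolding pre_def by (auto simp: image_subset_iff)
qed

context projective_setting
begin

lemma cohereditary_version: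
  assumes "pair_operation R \<C> \<P> p" "cofunctorial \<C> \<P> p"
  shows "is_cohereditary_version \<C> \<P> \<P>' p (cohereditary \<C> \<P> p)"
proof -
  have le: "\<pi> ` p (pre \<C> P \<pi> L) P \<subseteq> \<rho> ` p (pre \<C> Q \<rho> L) Q"
    if P: "projective_presentation \<C> \<P> L X P \<pi>" and Q: "projective_presentation \<C> \<P> L X Q \<rho>"
    for L X P \<pi> Q \<rho>
  proof (rule cohereditary_le[OF assms(2) P Q])
    have obj: "P \<in> Obj \<C>" "Q \<in> Obj \<C>"
      using P Q by (auto simp: projective_presentation_def projective_obj_def)
    show "h ` elts \<C> P \<subseteq> elts \<C> Q" if "h \<in> Mor \<C> P Q" for h
      using Mor_lin[OF obj] that by (fastforce simp: lin_def)
    have "submodule (p (pre \<C> P \<pi> L) P) R (Und \<C> P)"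
      using P assms(1) by (auto simp: projective_presentation_def pair_operation_def)
    then show "p (pre \<C> P \<pi> L) P \<subseteq> elts \<C> P"
      using Und_module[OF obj(1)] module.submoduleE(1) by blast
  qed
  have "cohereditary \<C> \<P> p L X = \<pi> ` p (pre \<C> P \<pi> L) P"
    if "projective_presentation \<C> \<P> L X P \<pi>" for L X P \<pi>
    unfolding cohereditary_def
  proof (rule the_equality)
    show "\<exists>Q \<rho>. projective_presentation \<C> \<P> L X Q \<rho> \<and>
        \<pi> ` p (pre \<C> P \<pi> L) P = \<rho> ` p (pre \<C> Q \<rho> L) Q"
      using that by blast
  qed (use le that in blast)
  then show ?thesis
    unfolding is_cohereditary_version_def using cover by blast
qed

end

context injective_setting
begin

lemma hereditary_version:
  assumes "functorial \<C> \<P> p"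
  shows "is_hereditary_version \<C> \<P> \<P>' p (hereditary \<C> \<P> p)"
proof -
  have sub: "A \<subseteq> elts \<C> B" if AB: "(A, B) \<in> \<P>'" for A B
  proof -
    obtain K k where k: "inj_mor \<C> K B k" "A = k ` elts \<C> K"
      using AB classes(2) by (auto simp: pair_class_def subobject_def)
    then have "k \<in> lin R (Und \<C> K) (Und \<C> B)"
      using Mor_lin by (auto simp: inj_mor_def)
    then show ?thesis
      using k(2) by (fastforce simp: lin_def)
  qed
  have "hereditary \<C> \<P> p A B = pre \<C> B i (p (i ` A) E)"
    if "(A, B) \<in> \<P>'" "injective_presentation \<C> \<P> A B E i" for A B E i
    unfolding hereditary_def
  proof (rule the_equality)
    show "\<exists>F j. injective_presentation \<C> \<P> A B F j \<and>
        pre \<C> B i (p (i ` A) E) = pre \<C> B j (p (j ` A) F)"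
      using that by blast
  qed (use hereditary_le[OF assms sub] that in blast)
  then show ?thesis
    unfolding is_hereditary_version_def using embed by blast
qed

end


section \<open>Matlis duality\<close>

text \<open>\<open>M\<^sup>\<or> = Hom(M, E)\<close>, where \<open>E\<close> is going to be the injective hull of the residue field.\<close>

definition matlis_dual ::
  "('a, 'r) ring_scheme \<Rightarrow> ('a, 'e) module \<Rightarrow> ('a, 'b) module \<Rightarrow> ('a, 'b \<Rightarrow> 'e) module" where
  "matlis_dual R E M = \<lparr>carrier = lin R M E, monoid.mult = undefined, one = undefined,
     zero = (\<lambda>x\<in>carrier M. \<zero>\<^bsub>E\<^esub>),
     add = (\<lambda>f g. \<lambda>x\<in>carrier M. f x \<oplus>\<^bsub>E\<^esub> g x),
     smult = (\<lambda>r f. \<lambda>x\<in>carrier M. r \<odot>\<^bsub>E\<^esub> f x)\<rparr>"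

definition dual_map ::
  "('a, 'r) ring_scheme \<Rightarrow> ('a, 'e) module \<Rightarrow> ('a, 'b) module \<Rightarrow> ('a, 'c) module \<Rightarrow>
   ('b \<Rightarrow> 'c) \<Rightarrow> ('c \<Rightarrow> 'e) \<Rightarrow> 'b \<Rightarrow> 'e" where
  "dual_map R E M N f = (\<lambda>g\<in>carrier (matlis_dual R E N). compose (carrier M) g f)"

definition eval_map ::
  "('a, 'r) ring_scheme \<Rightarrow> ('a, 'e) module \<Rightarrow> ('a, 'b) module \<Rightarrow> 'b \<Rightarrow> ('b \<Rightarrow> 'e) \<Rightarrow> 'e" where
  "eval_map R E M = (\<lambda>x\<in>carrier M. \<lambda>g\<in>carrier (matlis_dual R E M). g x)"

text \<open>\<open>(M/L)\<^sup>\<or>\<close> as a submodule of \<open>M\<^sup>\<or>\<close>, via the dual of \<open>M \<rightarrow> M/L\<close>.\<close>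

definition dual_quot ::
  "('a, 'r) ring_scheme \<Rightarrow> ('a, 'e) module \<Rightarrow> ('a, 'b) module \<Rightarrow> 'b set \<Rightarrow> ('b \<Rightarrow> 'e) set" where
  "dual_quot R E M L =
     dual_map R E M (quot_module M L) (quot_map M L) ` carrier (matlis_dual R E (quot_module M L))"

text \<open>The category of the modules \<open>M\<^sup>\<or>\<close> and the maps \<open>f\<^sup>\<or>\<close>.\<close>

definition dual_cat ::
  "('a, 'r) ring_scheme \<Rightarrow> ('a, 'e) module \<Rightarrow> ('a, 'b, 'o) modcat \<Rightarrow> ('a, 'b \<Rightarrow> 'e, 'o) modcat" where
  "dual_cat R E \<C> = \<lparr>Obj = Obj \<C>, Und = (\<lambda>X. matlis_dual R E (Und \<C> X)),
     Mor = (\<lambda>X Y. dual_map R E (Und \<C> Y) (Und \<C> X) ` Mor \<C> Y X)\<rparr>"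

text \<open>An object \<open>B\<close> of the dual category is \<open>X\<^sup>\<or>\<close> for an object \<open>X\<close> of the original one, and
  \<open>B\<^sup>\<or> = X\<^sup>\<or>\<^sup>\<or>\<close> is identified with \<open>X\<close> by evaluation.  Thus \<open>dual_sub R E \<C> A X\<close> is the submodule
  of \<open>X\<close> corresponding to \<open>(B/A)\<^sup>\<or> \<subseteq> B\<^sup>\<or>\<close>.\<close>

definition dual_sub ::
  "('a, 'r) ring_scheme \<Rightarrow> ('a, 'e) module \<Rightarrow> ('a, 'b, 'o) modcat \<Rightarrow> ('b \<Rightarrow> 'e) set \<Rightarrow> 'o \<Rightarrow> 'b set"
  where
  "dual_sub R E \<C> A X =
     {x \<in> elts \<C> X. eval_map R E (Und \<C> X) x \<in> dual_quot R E (matlis_dual R E (Und \<C> X)) A}"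

text \<open>\<open>\<Q>\<^sup>\<or> = {(A, B). ((B/A)\<^sup>\<or>, B\<^sup>\<or>) \<in> \<Q>}\<close>\<close>

definition dual_pairs ::
  "('a, 'r) ring_scheme \<Rightarrow> ('a, 'e) module \<Rightarrow> ('a, 'b, 'o) modcat \<Rightarrow> ('b set \<times> 'o) set \<Rightarrow>
   (('b \<Rightarrow> 'e) set \<times> 'o) set" where
  "dual_pairs R E \<C> \<Q> = {(A, X). X \<in> Obj \<C> \<and> subobject (dual_cat R E \<C>) X A \<and>
     (dual_sub R E \<C> A X, X) \<in> \<Q>}"

text \<open>For \<open>B = X\<^sup>\<or>\<close>, the value at \<open>(A, B)\<close> is the set of those \<open>b \<in> B\<close> which evaluation
  \<open>B \<rightarrow> B\<^sup>\<or>\<^sup>\<or>\<close> sends into \<open>(B\<^sup>\<or> / p((B/A)\<^sup>\<or>, B\<^sup>\<or>))\<^sup>\<or>\<close>.\<close>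

definition smile ::
  "('a, 'r) ring_scheme \<Rightarrow> ('a, 'e) module \<Rightarrow> ('a, 'b, 'o) modcat \<Rightarrow> ('b, 'o) pair_op \<Rightarrow>
   ('b \<Rightarrow> 'e, 'o) pair_op" where
  "smile R E \<C> p A X =
     (let B = matlis_dual R E (Und \<C> X)
      in {b \<in> carrier B. eval_map R E B b \<in>
            dual_quot R E (matlis_dual R E B)
              (eval_map R E (Und \<C> X) ` p (dual_sub R E \<C> A X) X)})"

end

theory Submission
  imports Defs
begin

text \<open>\<open>E\<close> is an injective cogenerator.  The value \<open>p\<^sup>\<smile>(A, X\<^sup>\<or>)\<close> is the annihilator in
  \<open>X\<^sup>\<or>\<close> of \<open>p(A\<^sup>\<bottom>, X)\<close>, where \<open>A\<^sup>\<bottom> \<subseteq> X\<close> consists of the common zeros of the forms in \<open>A\<close>.  Submodules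
  of \<open>X\<close> are recovered from their annihilators because \<open>E\<close> is a cogenerator, and a subobject \<open>A\<close> of
  \<open>X\<^sup>\<or>\<close> in the dual category is the image of some \<open>k\<^sup>\<or>\<close> with \<open>k\<close> surjective, hence the annihilator of
  \<open>ker k\<close>; so passing to annihilators is an order-reversing bijection on the relevant pairs.  It
  exchanges images and preimages, and \<open>f\<^sup>\<or>\<close> is injective (surjective) iff \<open>f\<close> is surjective
  (injective).  Hence projective presentations of \<open>(A\<^sup>\<bottom>, X)\<close> correspond to injective presentations of
  \<open>(A, X\<^sup>\<or>)\<close>, and dually.\<close>

section \<open>Linear maps and quotient modules\<close>

text \<open>\<open>injective_module\<close> tests only modules whose elements have the type of the
  ring, whereas forms have to be extended along maps between modules of any type. Injectivity is
  therefore first transferred by Baer's argument, and then used through a single extension lemma,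
  \<open>extend_along\<close>: applied to the ring as source it separates a submodule from a point
  outside it, applied to a morphism it computes the image of an annihilator under the dual map. A
  second obstacle is that \<C> need be closed neither under submodules nor under all linear maps.
  The annihilator of a submodule of X is then not automatically a subobject of the dual category,
  although pairs in a dual class must be subobjects. For the pairs that occur, this is recovered
  from composites of surjections in one direction and from kernels and cokernels of \<C> in the
  other. Objects of the dual category are the objects of \<C> themselves, so a morphism of the dual
  category is \<open>dual X Y f\<close> for some \<open>f\<close> of \<C>, and commuting triangles
  can be carried back and forth.\<close>

lemma lin_closed: "f \<in> lin R M N \<Longrightarrow> x \<in> carrier M \<Longrightarrow> f x \<in> carrier N"
  by (auto simp: lin_def)

lemma lin_add:
  "\<lbrakk>f \<in> lin R M N; x \<in> carrier M; y \<in> carrier M\<rbrakk> \<Longrightarrow> f (x \<oplus>\<^bsub>M\<^esub> y) = f x \<oplus>\<^bsub>N\<^esub> f y"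
  by (auto simp: lin_def)

lemma lin_smult:
  "\<lbrakk>f \<in> lin R M N; r \<in> carrier R; x \<in> carrier M\<rbrakk> \<Longrightarrow> f (r \<odot>\<^bsub>M\<^esub> x) = r \<odot>\<^bsub>N\<^esub> f x"
  by (auto simp: lin_def)

lemma lin_zero:
  assumes "module R M" "module R N" "f \<in> lin R M N"
  shows "f \<zero>\<^bsub>M\<^esub> = \<zero>\<^bsub>N\<^esub>"
proof -
  interpret M: module R M by fact
  interpret N: module R N by fact
  have "f (\<zero>\<^bsub>R\<^esub> \<odot>\<^bsub>M\<^esub> \<zero>\<^bsub>M\<^esub>) = \<zero>\<^bsub>R\<^esub> \<odot>\<^bsub>N\<^esub> f \<zero>\<^bsub>M\<^esub>"
    using assms(3) by (intro lin_smult) auto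
  then show ?thesis
    using lin_closed[OF assms(3)] by simp
qed

lemma lin_neg:
  assumes "module R M" "module R N" "f \<in> lin R M N" "x \<in> carrier M"
  shows "f (\<ominus>\<^bsub>M\<^esub> x) = \<ominus>\<^bsub>N\<^esub> f x"
proof -
  interpret M: module R M by fact
  interpret N: module R N by fact
  have "f ((\<ominus>\<^bsub>R\<^esub> \<one>\<^bsub>R\<^esub>) \<odot>\<^bsub>M\<^esub> x) = (\<ominus>\<^bsub>R\<^esub> \<one>\<^bsub>R\<^esub>) \<odot>\<^bsub>N\<^esub> f x"
    using assms(3,4) by (intro lin_smult) auto
  then show ?thesis
    using lin_closed[OF assms(3,4)] assms(4) by (simp add: M.smult_l_minus N.smult_l_minus)
qed

lemma linI:
  assumes "\<And>x. x \<in> carrier M \<Longrightarrow> f x \<in> carrier N"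
    and "\<And>x y. \<lbrakk>x \<in> carrier M; y \<in> carrier M\<rbrakk> \<Longrightarrow> f (x \<oplus>\<^bsub>M\<^esub> y) = f x \<oplus>\<^bsub>N\<^esub> f y"
    and "\<And>r x. \<lbrakk>r \<in> carrier R; x \<in> carrier M\<rbrakk> \<Longrightarrow> f (r \<odot>\<^bsub>M\<^esub> x) = r \<odot>\<^bsub>N\<^esub> f x"
    and "f \<in> extensional (carrier M)"
  shows "f \<in> lin R M N"
  using assms by (auto simp: lin_def PiE_iff)

lemma lin_compose:
  assumes "module R M" "f \<in> lin R M N" "g \<in> lin R N K"
  shows "compose (carrier M) g f \<in> lin R M K"
proof -
  interpret M: module R M by fact
  show ?thesis
    by (rule linI) (simp_all add: compose_def lin_closed[OF assms(2)] lin_closed[OF assms(3)]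
        lin_add[OF assms(2)] lin_add[OF assms(3)] lin_smult[OF assms(2)] lin_smult[OF assms(3)])
qed

lemma lin_eqI:
  assumes "f \<in> lin R M N" "g \<in> lin R M N" "\<And>x. x \<in> carrier M \<Longrightarrow> f x = g x"
  shows "f = g"
  using assms unfolding lin_def by (metis (no_types, lifting) PiE_ext mem_Collect_eq)

lemma submodule_image:
  assumes M: "module R M" and N: "module R N" and f: "f \<in> lin R M N" and H: "submodule H R M"
  shows "submodule (f ` H) R N"
proof -
  interpret M: module R M by fact
  interpret N: module R N by fact
  note HE = M.submoduleE[OF H]
  have sub: "x \<in> carrier M" if "x \<in> H" for x using HE(1) that by blast
  show ?thesis
  proof (rule N.submoduleI)
    show "f ` H \<subseteq> carrier N" using lin_closed[OF f] sub by blast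
    show "\<zero>\<^bsub>N\<^esub> \<in> f ` H"
      using lin_zero[OF M N f] submodule.axioms(1)[OF H] subgroup.one_closed by force
    show "\<ominus>\<^bsub>N\<^esub> a \<in> f ` H" if "a \<in> f ` H" for a
      using that HE(3) by (auto simp: sub lin_neg[OF M N f, symmetric])
    show "a \<oplus>\<^bsub>N\<^esub> b \<in> f ` H" if "a \<in> f ` H" "b \<in> f ` H" for a b
      using that HE(5) by (auto simp: sub lin_add[OF f, symmetric])
    show "r \<odot>\<^bsub>N\<^esub> a \<in> f ` H" if "r \<in> carrier R" "a \<in> f ` H" for r a
      using that HE(4) by (auto simp: sub lin_smult[OF f, symmetric])
  qed
qed

lemma submodule_pre:
  assumes M: "module R M" and N: "module R N" and f: "f \<in> lin R M N" and H: "submodule H R N"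
  shows "submodule {x \<in> carrier M. f x \<in> H} R M"
proof -
  interpret M: module R M by fact
  interpret N: module R N by fact
  note HE = N.submoduleE[OF H]
  have "\<zero>\<^bsub>N\<^esub> \<in> H"
    using submodule.axioms(1)[OF H] subgroup.one_closed by force
  then show ?thesis
    using HE by (intro M.submoduleI)
      (auto simp: lin_zero[OF M N f] lin_neg[OF M N f] lin_add[OF f] lin_smult[OF f])
qed

lemma zero_submodule:
  assumes "module R M"
  shows "submodule {\<zero>\<^bsub>M\<^esub>} R M"
proof -
  interpret M: module R M by fact
  show ?thesis by (intro M.submoduleI) auto
qed

section \<open>The ring as a module over itself\<close>

lemma (in cring) regular_module: "module R (regular_module R)"
  unfolding regular_module_def
  by (rule moduleI) (auto intro!: abelian_groupI cring_axioms simp: l_distr r_distr m_assoc a_ac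
      intro: l_neg add.inv_closed bexI[of _ "\<ominus> _"])

lemma (in cring) ideal_submodule:
  assumes "ideal I R"
  shows "submodule I R (regular_module R)"
proof -
  interpret I: ideal I R by fact
  interpret M: module R "regular_module R" by (rule regular_module)
  \<comment> \<open>Negation in \<open>regular_module R\<close> is formed in the additive monoid of
    another record; uniqueness of inverses identifies it with negation in the ring.\<close>
  have neg: "\<ominus>\<^bsub>regular_module R\<^esub> x = \<ominus> x" if "x \<in> carrier R" for x
    using that by (intro M.minus_equality) (auto simp: regular_module_def l_neg)
  show ?thesis
    by (intro M.submoduleI) (auto simp: neg, auto simp: regular_module_def I.I_l_closed)
qed

section \<open>Quotient modules: cosets, scalar action, universal property\<close>

context
  fixes R :: "('a, 'r) ring_scheme" and M :: "('a, 'b) module" and L :: "'b set"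
  assumes M: "module R M" and L: "submodule L R M"
begin

interpretation M: module R M by (rule M)

lemma submodule_abelian_subgroup: "abelian_subgroup L M"
  using submodule.axioms(1)[OF L]
  by (intro abelian_subgroupI3 M.abelian_group_axioms additive_subgroupI)

interpretation L: abelian_subgroup L M by (rule submodule_abelian_subgroup)

lemma quot_map_eq_iff:
  assumes "x \<in> carrier M" "y \<in> carrier M"
  shows "L +>\<^bsub>M\<^esub> x = L +>\<^bsub>M\<^esub> y \<longleftrightarrow> x \<oplus>\<^bsub>M\<^esub> \<ominus>\<^bsub>M\<^esub> y \<in> L"
proof -
  have "L +>\<^bsub>M\<^esub> x = L +>\<^bsub>M\<^esub> y \<longleftrightarrow> x \<in> L +>\<^bsub>M\<^esub> y"
    using assms L.a_repr_independence' L.a_repr_independenceD by blast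
  then show ?thesis
    using L.a_rcos_module[OF assms(2,1)] by blast
qed

text \<open>The action on a coset is defined as a union over all its representatives. The union
  collapses: if \<open>y\<close> and \<open>x\<close> differ by an element of \<open>L\<close>, so
  do their multiples by \<open>r\<close>, hence all sets in the union are the same coset.\<close>

lemma smult_quot:
  assumes r: "r \<in> carrier R" and x: "x \<in> carrier M"
  shows "r \<odot>\<^bsub>quot_module M L\<^esub> (L +>\<^bsub>M\<^esub> x) = L +>\<^bsub>M\<^esub> (r \<odot>\<^bsub>M\<^esub> x)"
proof -
  have "L +>\<^bsub>M\<^esub> (r \<odot>\<^bsub>M\<^esub> y) = L +>\<^bsub>M\<^esub> (r \<odot>\<^bsub>M\<^esub> x)" if "y \<in> L +>\<^bsub>M\<^esub> x" for y
  proof -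
    have y: "y \<in> carrier M" using L.a_elemrcos_carrier x that by blast
    have "y \<oplus>\<^bsub>M\<^esub> \<ominus>\<^bsub>M\<^esub> x \<in> L" by (rule L.a_rcos_module_imp[OF x that])
    then have "r \<odot>\<^bsub>M\<^esub> (y \<oplus>\<^bsub>M\<^esub> \<ominus>\<^bsub>M\<^esub> x) \<in> L" by (rule submodule.smult_closed[OF L r])
    then have "r \<odot>\<^bsub>M\<^esub> y \<oplus>\<^bsub>M\<^esub> \<ominus>\<^bsub>M\<^esub> (r \<odot>\<^bsub>M\<^esub> x) \<in> L"
      using r x y by (simp add: M.smult_r_distr M.smult_r_minus)
    then show ?thesis using r x y by (simp add: quot_map_eq_iff)
  qed
  then have "(\<Union>y\<in>L +>\<^bsub>M\<^esub> x. L +>\<^bsub>M\<^esub> (r \<odot>\<^bsub>M\<^esub> y)) = L +>\<^bsub>M\<^esub> (r \<odot>\<^bsub>M\<^esub> x)"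
    using L.a_rcos_self[OF x] by (intro SUP_eq_const) blast+
  then show ?thesis by (simp add: quot_module_def)
qed

lemma add_quot:
  assumes "x \<in> carrier M" "y \<in> carrier M"
  shows "(L +>\<^bsub>M\<^esub> x) \<oplus>\<^bsub>quot_module M L\<^esub> (L +>\<^bsub>M\<^esub> y) = L +>\<^bsub>M\<^esub> (x \<oplus>\<^bsub>M\<^esub> y)"
  using L.a_rcos_sum[OF assms] by (simp add: quot_module_def)

lemma carrier_quot: "carrier (quot_module M L) = (\<lambda>x. L +>\<^bsub>M\<^esub> x) ` carrier M"
  by (auto simp: quot_module_def A_RCOSETS_def')

lemma quot_map_lin: "quot_map M L \<in> lin R M (quot_module M L)"
  by (rule linI) (auto simp: quot_map_def carrier_quot smult_quot add_quot)

lemma quot_map_factor: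
  assumes N: "module R N" and f: "f \<in> lin R M N" and L0: "\<And>x. x \<in> L \<Longrightarrow> f x = \<zero>\<^bsub>N\<^esub>"
  shows "\<exists>g\<in>lin R (quot_module M L) N. \<forall>x\<in>carrier M. g (L +>\<^bsub>M\<^esub> x) = f x"
proof -
  interpret N: module R N by (rule N)
  \<comment> \<open>An arbitrary representative is chosen; two of them differ by an element of
    \<open>L\<close>, which \<open>f\<close> kills. The restriction to the carrier makes
    \<open>g\<close> extensional, as \<open>lin\<close> demands.\<close>
  define g where "g = (\<lambda>X\<in>carrier (quot_module M L). f (SOME x. x \<in> X))"
  have g: "g (L +>\<^bsub>M\<^esub> x) = f x" if x: "x \<in> carrier M" for x
  proof -
    define y where "y = (SOME y. y \<in> L +>\<^bsub>M\<^esub> x)"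
    have y': "y \<in> L +>\<^bsub>M\<^esub> x" unfolding y_def by (rule someI, rule L.a_rcos_self[OF x])
    have y: "y \<in> carrier M" by (rule L.a_elemrcos_carrier[OF x y'])
    have "f (y \<oplus>\<^bsub>M\<^esub> \<ominus>\<^bsub>M\<^esub> x) = \<zero>\<^bsub>N\<^esub>" by (rule L0[OF L.a_rcos_module_imp[OF x y']])
    then have "f y \<oplus>\<^bsub>N\<^esub> \<ominus>\<^bsub>N\<^esub> f x = \<zero>\<^bsub>N\<^esub>"
      using x y lin_add[OF f] lin_neg[OF M N f] by simp
    then have "f y = f x"
      using x y lin_closed[OF f] by (metis N.add.inv_closed N.minus_equality N.minus_minus N.a_comm)
    then show ?thesis
      using x by (simp add: g_def carrier_quot y_def)
  qed
  moreover have "g \<in> lin R (quot_module M L) N"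
    by (rule linI) (auto simp: carrier_quot add_quot smult_quot g lin_closed[OF f] lin_add[OF f]
        lin_smult[OF f], simp add: g_def carrier_quot)
  ultimately show ?thesis by blast
qed

end

section \<open>Injectivity over arbitrary modules\<close>

text \<open>A linear map on an unnamed submodule of \<open>M\<close>, given by its graph, so that
  extension is inclusion and Zorn's lemma for sets applies. The last clause replaces
  single-valuedness: for a graph closed under addition and scalars the fibre over zero decides
  it.\<close>

definition partial_lin ::
  "('a, 'r) ring_scheme \<Rightarrow> ('a, 'b) module \<Rightarrow> ('a, 'c) module \<Rightarrow> ('b \<times> 'c) set \<Rightarrow> bool" where
  "partial_lin R M N G \<longleftrightarrow> G \<subseteq> carrier M \<times> carrier N \<and> (\<zero>\<^bsub>M\<^esub>, \<zero>\<^bsub>N\<^esub>) \<in> G \<and>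
     (\<forall>x a y b. (x, a) \<in> G \<and> (y, b) \<in> G \<longrightarrow> (x \<oplus>\<^bsub>M\<^esub> y, a \<oplus>\<^bsub>N\<^esub> b) \<in> G) \<and>
     (\<forall>r x a. r \<in> carrier R \<and> (x, a) \<in> G \<longrightarrow> (r \<odot>\<^bsub>M\<^esub> x, r \<odot>\<^bsub>N\<^esub> a) \<in> G) \<and>
     (\<forall>a. (\<zero>\<^bsub>M\<^esub>, a) \<in> G \<longrightarrow> a = \<zero>\<^bsub>N\<^esub>)"

lemma partial_lin_Union:
  assumes "\<C> \<noteq> {}" and chain: "subset.chain {G. partial_lin R M N G} \<C>"
  shows "partial_lin R M N (\<Union>\<C>)"
proof -
  have G: "partial_lin R M N G" if "G \<in> \<C>" for G
    using that chain by (auto simp: subset_chain_def)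
  have nested: "G \<subseteq> H \<or> H \<subseteq> G" if "G \<in> \<C>" "H \<in> \<C>" for G H
    using that chain by (auto simp: subset_chain_def)
  show ?thesis
    unfolding partial_lin_def
  proof (intro conjI allI impI; (elim conjE)?)
    show "(x \<oplus>\<^bsub>M\<^esub> y, a \<oplus>\<^bsub>N\<^esub> b) \<in> \<Union>\<C>" if xa: "(x, a) \<in> \<Union>\<C>" and yb: "(y, b) \<in> \<Union>\<C>" for x a y b
    proof -
      obtain G where G1: "G \<in> \<C>" "(x, a) \<in> G" using xa by (rule UnionE)
      obtain H where H: "H \<in> \<C>" "(y, b) \<in> H" using yb by (rule UnionE)
      obtain K where "K \<in> \<C>" "(x, a) \<in> K" "(y, b) \<in> K"
        using nested[OF G1(1) H(1)] G1 H by (meson subsetD)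
      then show ?thesis
        using G[of K] unfolding partial_lin_def by (meson UnionI)
    qed
    show "\<Union>\<C> \<subseteq> carrier M \<times> carrier N"
      by (rule Union_least) (use G in \<open>simp add: partial_lin_def\<close>)
    show "(\<zero>\<^bsub>M\<^esub>, \<zero>\<^bsub>N\<^esub>) \<in> \<Union>\<C>"
    proof -
      obtain K where "K \<in> \<C>" using assms(1) by blast
      then show ?thesis using G[of K] by (auto simp: partial_lin_def)
    qed
    show "(r \<odot>\<^bsub>M\<^esub> x, r \<odot>\<^bsub>N\<^esub> a) \<in> \<Union>\<C>" if r: "r \<in> carrier R" and xa: "(x, a) \<in> \<Union>\<C>" for r x a
    proof -
      obtain K where K: "K \<in> \<C>" "(x, a) \<in> K" using xa by (rule UnionE)
      have "(r \<odot>\<^bsub>M\<^esub> x, r \<odot>\<^bsub>N\<^esub> a) \<in> K"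
        using G[OF K(1)] K(2) r unfolding partial_lin_def by blast
      then show ?thesis using K(1) by (rule UnionI[rotated])
    qed
    show "a = \<zero>\<^bsub>N\<^esub>" if za: "(\<zero>\<^bsub>M\<^esub>, a) \<in> \<Union>\<C>" for a
    proof -
      obtain K where "K \<in> \<C>" "(\<zero>\<^bsub>M\<^esub>, a) \<in> K" using za by (rule UnionE)
      then show ?thesis using G[of K] by (simp add: partial_lin_def)
    qed
  qed
qed

text \<open>The difference of the two pairs lies in the graph and has first component zero.
  Subtraction is obtained as scaling by -1, since closure under scalars is what the definition
  offers.\<close>

lemma partial_lin_unique:
  assumes M: "module R M" and N: "module R N" and G: "partial_lin R M N G"
    and "(x, a) \<in> G" "(x, b) \<in> G"
  shows "a = b"
proof -
  interpret M: module R M by (rule M)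
  interpret N: module R N by (rule N)
  have carr: "x \<in> carrier M" "a \<in> carrier N" "b \<in> carrier N"
    using G assms(4,5) unfolding partial_lin_def by auto
  have "((\<ominus>\<^bsub>R\<^esub> \<one>\<^bsub>R\<^esub>) \<odot>\<^bsub>M\<^esub> x, (\<ominus>\<^bsub>R\<^esub> \<one>\<^bsub>R\<^esub>) \<odot>\<^bsub>N\<^esub> b) \<in> G"
    using G assms(5) unfolding partial_lin_def by simp
  then have "(\<ominus>\<^bsub>M\<^esub> x, \<ominus>\<^bsub>N\<^esub> b) \<in> G"
    using carr by (simp add: M.smult_l_minus N.smult_l_minus)
  with assms(4) G have "(x \<oplus>\<^bsub>M\<^esub> \<ominus>\<^bsub>M\<^esub> x, a \<oplus>\<^bsub>N\<^esub> \<ominus>\<^bsub>N\<^esub> b) \<in> G"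
    unfolding partial_lin_def by blast
  then have "a \<oplus>\<^bsub>N\<^esub> \<ominus>\<^bsub>N\<^esub> b = \<zero>\<^bsub>N\<^esub>"
    using G carr unfolding partial_lin_def by (simp add: M.r_neg)
  then show ?thesis
    using carr by (metis N.add.inv_closed N.minus_equality N.minus_minus)
qed

text \<open>The point at which the lifting property in \<open>injective_module\<close> is applied:
  an ideal and the ring both have elements of the ring's type, so the inclusion is an admissible
  test. The extension to the whole ring is determined by its value \<open>e\<close> at one.\<close>

lemma injective_extend_ideal:
  assumes inj: "injective_module R E" and I: "ideal I R"
    and f: "f \<in> lin R (regular_module R\<lparr>carrier := I\<rparr>) E"
  obtains e where "e \<in> carrier E" "\<And>r. r \<in> I \<Longrightarrow> f r = r \<odot>\<^bsub>E\<^esub> e"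
proof -
  interpret E: module R E using inj by (simp add: injective_module_def)
  interpret I: ideal I R by (rule I)
  let ?R = "regular_module R"
  have M: "module R (?R\<lparr>carrier := I\<rparr>)"
    by (rule submodule.submodule_is_module[OF E.ideal_submodule[OF I] E.regular_module])
  have inc: "(\<lambda>x\<in>I. x) \<in> lin R (?R\<lparr>carrier := I\<rparr>) ?R"
    by (rule linI) (auto simp: regular_module_def I.I_l_closed)
  obtain g where g: "g \<in> lin R ?R E" "\<And>x. x \<in> I \<Longrightarrow> g x = f x"
  proof -
    have "\<exists>g\<in>lin R ?R E. \<forall>x\<in>carrier (?R\<lparr>carrier := I\<rparr>). g ((\<lambda>x\<in>I. x) x) = f x"
    proof (rule inj[unfolded injective_module_def, THEN conjunct2, rule_format], intro conjI)
      show "inj_on (\<lambda>x\<in>I. x) (carrier (?R\<lparr>carrier := I\<rparr>))" by (simp add: inj_on_def)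
    qed (rule M E.regular_module inc f)+
    then show thesis using that by auto
  qed
  show thesis
  proof (rule that[of "g \<one>\<^bsub>R\<^esub>"])
    show "g \<one>\<^bsub>R\<^esub> \<in> carrier E"
      by (rule lin_closed[OF g(1)]) (simp add: regular_module_def)
    show "f r = r \<odot>\<^bsub>E\<^esub> g \<one>\<^bsub>R\<^esub>" if "r \<in> I" for r
      using lin_smult[OF g(1), of r "\<one>\<^bsub>R\<^esub>"] g(2)[OF that] that I.Icarr[OF that]
      by (simp add: regular_module_def)
  qed
qed

text \<open>Baer's argument: by Zorn's lemma it is enough to enlarge the domain of a partial map by one
  element \<open>x\<close>, and for this it is enough to extend the induced map on the ideal of those \<open>r\<close> for which
  \<open>r x\<close> lies in the domain.\<close>

lemma partial_lin_enlarge: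
  assumes inj: "injective_module R E" and M: "module R M" and G: "partial_lin R M E G"
    and x: "x \<in> carrier M"
  obtains G' a where "partial_lin R M E G'" "G \<subseteq> G'" "(x, a) \<in> G'"
proof -
  interpret M: module R M by (rule M)
  have E: "module R E" using inj by (simp add: injective_module_def)
  interpret E: module R E by (rule E)
  have Gsub: "y \<in> carrier M" "a \<in> carrier E" if "(y, a) \<in> G" for y a
    using G that unfolding partial_lin_def by auto
  have G0: "(\<zero>\<^bsub>M\<^esub>, \<zero>\<^bsub>E\<^esub>) \<in> G"
    using G unfolding partial_lin_def by blast
  have Gadd: "(y \<oplus>\<^bsub>M\<^esub> z, a \<oplus>\<^bsub>E\<^esub> b) \<in> G" if "(y, a) \<in> G" "(z, b) \<in> G" for y z a b
    using G that unfolding partial_lin_def by blast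
  have Gsm: "(r \<odot>\<^bsub>M\<^esub> y, r \<odot>\<^bsub>E\<^esub> a) \<in> G" if "r \<in> carrier R" "(y, a) \<in> G" for r y a
    using G that unfolding partial_lin_def by blast
  note Guniq = partial_lin_unique[OF M E G]
  define I where "I = {r \<in> carrier R. \<exists>a. (r \<odot>\<^bsub>M\<^esub> x, a) \<in> G}"
  define h where "h = (\<lambda>r\<in>I. THE a. (r \<odot>\<^bsub>M\<^esub> x, a) \<in> G)"
  have h: "h r = a" if "r \<in> carrier R" "(r \<odot>\<^bsub>M\<^esub> x, a) \<in> G" for r a
    using that Guniq by (auto simp: h_def I_def intro!: the_equality)
  have I_mult: "s \<otimes>\<^bsub>R\<^esub> r \<in> I" if "r \<in> I" "s \<in> carrier R" for r s
    using that Gsm x by (auto simp: I_def M.smult_assoc1)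
  have I: "ideal I R"
  proof (rule idealI)
    show "subgroup I (add_monoid R)"
    proof (rule M.R.add.subgroupI)
      show "I \<subseteq> carrier R" by (auto simp: I_def)
      have "\<zero>\<^bsub>R\<^esub> \<in> I" using G0 x by (auto simp: I_def)
      then show "I \<noteq> {}" by blast
      show "\<ominus>\<^bsub>R\<^esub> r \<in> I" if "r \<in> I" for r
        using I_mult[OF that, of "\<ominus>\<^bsub>R\<^esub> \<one>\<^bsub>R\<^esub>"] that by (simp add: I_def M.l_minus)
      show "r \<oplus>\<^bsub>R\<^esub> s \<in> I" if "r \<in> I" "s \<in> I" for r s
        using that x by (auto simp: I_def M.smult_l_distr intro: Gadd)
    qed
    show "r \<otimes>\<^bsub>R\<^esub> s \<in> I" if "r \<in> I" "s \<in> carrier R" for r s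
      using I_mult[OF that] that by (simp add: I_def M.m_comm)
  qed (use I_mult M.ring_axioms in auto)
  have "h \<in> lin R (regular_module R\<lparr>carrier := I\<rparr>) E"
  proof (rule linI)
    fix r assume r: "r \<in> carrier (regular_module R\<lparr>carrier := I\<rparr>)"
    then obtain a where a: "r \<in> carrier R" "(r \<odot>\<^bsub>M\<^esub> x, a) \<in> G" by (auto simp: I_def)
    then show "h r \<in> carrier E" using h Gsub by auto
    show "h (s \<odot>\<^bsub>regular_module R\<lparr>carrier := I\<rparr>\<^esub> r) = s \<odot>\<^bsub>E\<^esub> h r" if "s \<in> carrier R" for s
      using a that Gsm[OF that a(2)] x by (simp add: regular_module_def h M.smult_assoc1)
    show "h (r \<oplus>\<^bsub>regular_module R\<lparr>carrier := I\<rparr>\<^esub> s) = h r \<oplus>\<^bsub>E\<^esub> h s"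
      if "s \<in> carrier (regular_module R\<lparr>carrier := I\<rparr>)" for s
    proof -
      obtain b where b: "s \<in> carrier R" "(s \<odot>\<^bsub>M\<^esub> x, b) \<in> G" using \<open>s \<in> _\<close> by (auto simp: I_def)
      show ?thesis
        using a b Gadd[OF a(2) b(2)] x by (simp add: regular_module_def h M.smult_l_distr)
    qed
  qed (simp add: h_def)
  then obtain e where e: "e \<in> carrier E" "\<And>r. r \<in> I \<Longrightarrow> h r = r \<odot>\<^bsub>E\<^esub> e"
    using injective_extend_ideal[OF inj I] by blast
  \<comment> \<open>\<open>e\<close> is the value assigned to \<open>x\<close>. On those multiples
    of \<open>x\<close> that already lie in the domain of \<open>G\<close> it agrees with the values
    prescribed by \<open>G\<close>.\<close>
  define G' where "G' = (\<lambda>((y, a), r). (y \<oplus>\<^bsub>M\<^esub> r \<odot>\<^bsub>M\<^esub> x, a \<oplus>\<^bsub>E\<^esub> r \<odot>\<^bsub>E\<^esub> e)) ` (G \<times> carrier R)"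
  have G'I: "(y \<oplus>\<^bsub>M\<^esub> r \<odot>\<^bsub>M\<^esub> x, a \<oplus>\<^bsub>E\<^esub> r \<odot>\<^bsub>E\<^esub> e) \<in> G'" if "(y, a) \<in> G" "r \<in> carrier R" for y a r
    using that by (force simp: G'_def)
  have G'E: "\<exists>y a r. (y, a) \<in> G \<and> r \<in> carrier R \<and> u = y \<oplus>\<^bsub>M\<^esub> r \<odot>\<^bsub>M\<^esub> x \<and> b = a \<oplus>\<^bsub>E\<^esub> r \<odot>\<^bsub>E\<^esub> e"
    if "(u, b) \<in> G'" for u b
    using that by (auto simp: G'_def)
  have "partial_lin R M E G'"
    unfolding partial_lin_def
  proof (intro conjI allI impI)
    show "G' \<subseteq> carrier M \<times> carrier E"
      using x e(1) Gsub by (auto simp: G'_def)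
    show "(\<zero>\<^bsub>M\<^esub>, \<zero>\<^bsub>E\<^esub>) \<in> G'"
      using G'I[OF G0 M.R.zero_closed] x e(1) by simp
    show "(u \<oplus>\<^bsub>M\<^esub> v, b \<oplus>\<^bsub>E\<^esub> c) \<in> G'" if uv: "(u, b) \<in> G' \<and> (v, c) \<in> G'" for u b v c
    proof -
      obtain y a r where y: "(y, a) \<in> G" "r \<in> carrier R" "u = y \<oplus>\<^bsub>M\<^esub> r \<odot>\<^bsub>M\<^esub> x"
        "b = a \<oplus>\<^bsub>E\<^esub> r \<odot>\<^bsub>E\<^esub> e" using uv G'E by blast
      obtain z d s where z: "(z, d) \<in> G" "s \<in> carrier R" "v = z \<oplus>\<^bsub>M\<^esub> s \<odot>\<^bsub>M\<^esub> x"
        "c = d \<oplus>\<^bsub>E\<^esub> s \<odot>\<^bsub>E\<^esub> e" using uv G'E by blast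
      have "u \<oplus>\<^bsub>M\<^esub> v = (y \<oplus>\<^bsub>M\<^esub> z) \<oplus>\<^bsub>M\<^esub> (r \<oplus>\<^bsub>R\<^esub> s) \<odot>\<^bsub>M\<^esub> x"
        using y z x Gsub by (simp add: M.smult_l_distr M.a_ac)
      moreover have "b \<oplus>\<^bsub>E\<^esub> c = (a \<oplus>\<^bsub>E\<^esub> d) \<oplus>\<^bsub>E\<^esub> (r \<oplus>\<^bsub>R\<^esub> s) \<odot>\<^bsub>E\<^esub> e"
        using y z e(1) Gsub by (simp add: E.smult_l_distr E.a_ac)
      ultimately show ?thesis
        using G'I[OF Gadd[OF y(1) z(1)], of "r \<oplus>\<^bsub>R\<^esub> s"] y(2) z(2) by simp
    qed
    show "(s \<odot>\<^bsub>M\<^esub> u, s \<odot>\<^bsub>E\<^esub> b) \<in> G'" if su: "s \<in> carrier R \<and> (u, b) \<in> G'" for s u b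
    proof -
      obtain y a r where y: "(y, a) \<in> G" "r \<in> carrier R" "u = y \<oplus>\<^bsub>M\<^esub> r \<odot>\<^bsub>M\<^esub> x"
        "b = a \<oplus>\<^bsub>E\<^esub> r \<odot>\<^bsub>E\<^esub> e" using su G'E by blast
      then show ?thesis
        using G'I[OF Gsm[of s, OF _ y(1)], of "s \<otimes>\<^bsub>R\<^esub> r"] su x e(1) Gsub
        by (simp add: M.smult_r_distr E.smult_r_distr M.smult_assoc1 E.smult_assoc1)
    qed
    \<comment> \<open>The sum of the old domain and the multiples of \<open>x\<close> need not be
      direct, so the value could be ambiguous. If \<open>y\<close> and \<open>r\<close> times
      \<open>x\<close> cancel, then \<open>r\<close> lies in \<open>I\<close>, and the choice of
      \<open>e\<close> makes the values cancel as well.\<close>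
    show "b = \<zero>\<^bsub>E\<^esub>" if b: "(\<zero>\<^bsub>M\<^esub>, b) \<in> G'" for b
    proof -
      obtain y a r where y: "(y, a) \<in> G" "r \<in> carrier R" "\<zero>\<^bsub>M\<^esub> = y \<oplus>\<^bsub>M\<^esub> r \<odot>\<^bsub>M\<^esub> x"
        "b = a \<oplus>\<^bsub>E\<^esub> r \<odot>\<^bsub>E\<^esub> e" using b G'E by blast
      have "r \<odot>\<^bsub>M\<^esub> x = \<ominus>\<^bsub>M\<^esub> y"
        using y x Gsub by (metis M.M.a_comm M.M.minus_equality M.smult_closed)
      moreover have "(\<ominus>\<^bsub>M\<^esub> y, \<ominus>\<^bsub>E\<^esub> a) \<in> G"
        using Gsm[of "\<ominus>\<^bsub>R\<^esub> \<one>\<^bsub>R\<^esub>", OF _ y(1)] Gsub[OF y(1)] by (simp add: M.smult_l_minus E.smult_l_minus)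
      ultimately have r: "(r \<odot>\<^bsub>M\<^esub> x, \<ominus>\<^bsub>E\<^esub> a) \<in> G" by simp
      then have "r \<in> I" using y(2) by (auto simp: I_def)
      then have "r \<odot>\<^bsub>E\<^esub> e = \<ominus>\<^bsub>E\<^esub> a"
        using e(2)[of r] h[OF y(2) r] by simp
      then show ?thesis
        using y(4) Gsub[OF y(1)] by (simp add: E.M.r_neg)
    qed
  qed
  moreover have "G \<subseteq> G'"
  proof clarify
    fix y a assume "(y, a) \<in> G"
    then show "(y, a) \<in> G'"
      using G'I[OF _ M.R.zero_closed, of y a] x e(1) Gsub by simp
  qed
  moreover have "(x, e) \<in> G'"
    using G'I[OF G0 M.R.one_closed] x e(1) by simp
  ultimately show thesis using that by blast
qed

text \<open>Since the data are a graph, a map given by a formula on a submodule can be supplied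
  without first choosing representatives; only the fibre over zero has to be checked.\<close>

theorem partial_lin_extend:
  assumes inj: "injective_module R E" and M: "module R M" and G: "partial_lin R M E G"
  shows "\<exists>f\<in>lin R M E. \<forall>(x, a)\<in>G. f x = a"
proof -
  have E: "module R E" using inj by (simp add: injective_module_def)
  let ?A = "{H. partial_lin R M E H \<and> G \<subseteq> H}"
  have "\<exists>H\<in>?A. \<forall>X\<in>?A. H \<subseteq> X \<longrightarrow> X = H"
  proof (rule subset_Zorn_nonempty)
    show "?A \<noteq> {}" using G by blast
    fix \<C> assume C: "\<C> \<noteq> {}" "subset.chain ?A \<C>"
    then have "subset.chain {H. partial_lin R M E H} \<C>"
      by (auto simp: subset_chain_def)
    then have "partial_lin R M E (\<Union>\<C>)"
      by (rule partial_lin_Union[OF C(1)])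
    moreover have "G \<subseteq> \<Union>\<C>"
      using C by (force simp: subset_chain_def)
    ultimately show "\<Union>\<C> \<in> ?A" by blast
  qed
  then obtain H where "H \<in> ?A" and H_max: "\<forall>X\<in>?A. H \<subseteq> X \<longrightarrow> X = H" by (rule bexE)
  then have H: "partial_lin R M E H" "G \<subseteq> H" by simp_all
  have max: "X = H" if "partial_lin R M E X" "H \<subseteq> X" for X
    using H_max[rule_format, of X] that H(2) by simp
  note uniq = partial_lin_unique[OF M E H(1)]
  have total: "\<exists>a. (x, a) \<in> H" if x: "x \<in> carrier M" for x
  proof -
    obtain G' a where "partial_lin R M E G'" "H \<subseteq> G'" "(x, a) \<in> G'"
      by (rule partial_lin_enlarge[OF inj M H(1) x])
    then show ?thesis using max[of G'] by auto
  qed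
  define f where "f = (\<lambda>x\<in>carrier M. THE a. (x, a) \<in> H)"
  have carr: "x \<in> carrier M" "a \<in> carrier E" if "(x, a) \<in> H" for x a
    using H(1) that unfolding partial_lin_def by auto
  have Hadd: "(x \<oplus>\<^bsub>M\<^esub> y, a \<oplus>\<^bsub>E\<^esub> b) \<in> H" if "(x, a) \<in> H" "(y, b) \<in> H" for x y a b
    using H(1) that unfolding partial_lin_def by blast
  have Hsm: "(r \<odot>\<^bsub>M\<^esub> x, r \<odot>\<^bsub>E\<^esub> a) \<in> H" if "r \<in> carrier R" "(x, a) \<in> H" for r x a
    using H(1) that unfolding partial_lin_def by blast
  have f: "f x = a" if "(x, a) \<in> H" for x a
    using that uniq carr[OF that] by (auto simp: f_def intro!: the_equality)
  have fH: "(x, f x) \<in> H" if "x \<in> carrier M" for x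
    using total[OF that] f by auto
  have "f \<in> lin R M E"
  proof (rule linI)
    show "f x \<in> carrier E" if "x \<in> carrier M" for x
      using carr[OF fH[OF that]] by blast
    show "f (x \<oplus>\<^bsub>M\<^esub> y) = f x \<oplus>\<^bsub>E\<^esub> f y" if "x \<in> carrier M" "y \<in> carrier M" for x y
      by (rule f, rule Hadd) (use that fH in auto)
    show "f (r \<odot>\<^bsub>M\<^esub> x) = r \<odot>\<^bsub>E\<^esub> f x" if "r \<in> carrier R" "x \<in> carrier M" for r x
      by (rule f, rule Hsm) (use that fH in auto)
  qed (simp add: f_def)
  then show ?thesis
    using f H(2) by blast
qed

section \<open>Annihilators in the dual module\<close>

text \<open>The elementwise form of \<open>dual_quot\<close>, see \<open>dual_quot_eq\<close>; it
  avoids cosets and makes sense for any set \<open>L\<close>.\<close>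

definition ann ::
  "('a, 'r) ring_scheme \<Rightarrow> ('a, 'e) module \<Rightarrow> ('a, 'b) module \<Rightarrow> 'b set \<Rightarrow> ('b \<Rightarrow> 'e) set" where
  "ann R E M L = {f \<in> lin R M E. \<forall>x\<in>L. f x = \<zero>\<^bsub>E\<^esub>}"

text \<open>The elementwise form of \<open>dual_sub\<close>, see \<open>dual_sub_eq\<close>:
  evaluation at \<open>x\<close> kills \<open>A\<close> exactly if all forms in \<open>A\<close>
  vanish at \<open>x\<close>.\<close>

definition coann :: "('a, 'e) module \<Rightarrow> ('a, 'b) module \<Rightarrow> ('b \<Rightarrow> 'e) set \<Rightarrow> 'b set" where
  "coann E M A = {x \<in> carrier M. \<forall>f\<in>A. f x = \<zero>\<^bsub>E\<^esub>}"

lemma annD: "f \<in> ann R E M L \<Longrightarrow> x \<in> L \<Longrightarrow> f x = \<zero>\<^bsub>E\<^esub>"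
  by (simp add: ann_def)

lemma ann_lin: "f \<in> ann R E M L \<Longrightarrow> f \<in> lin R M E"
  by (simp add: ann_def)

lemma ann_anti: "L \<subseteq> N \<Longrightarrow> ann R E M N \<subseteq> ann R E M L"
  by (auto simp: ann_def)

lemma coann_anti: "A \<subseteq> B \<Longrightarrow> coann E M B \<subseteq> coann E M A"
  by (auto simp: coann_def)

lemma coannI: "x \<in> carrier M \<Longrightarrow> (\<And>f. f \<in> A \<Longrightarrow> f x = \<zero>\<^bsub>E\<^esub>) \<Longrightarrow> x \<in> coann E M A"
  by (simp add: coann_def)

lemma coannD: "x \<in> coann E M A \<Longrightarrow> f \<in> A \<Longrightarrow> f x = \<zero>\<^bsub>E\<^esub>"
  by (simp add: coann_def)

lemma coann_carrier: "x \<in> coann E M A \<Longrightarrow> x \<in> carrier M"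
  by (simp add: coann_def)

lemma dual_simps [simp]:
  "carrier (matlis_dual R E M) = lin R M E"
  "\<zero>\<^bsub>matlis_dual R E M\<^esub> = (\<lambda>x\<in>carrier M. \<zero>\<^bsub>E\<^esub>)"
  "f \<oplus>\<^bsub>matlis_dual R E M\<^esub> g = (\<lambda>x\<in>carrier M. f x \<oplus>\<^bsub>E\<^esub> g x)"
  "r \<odot>\<^bsub>matlis_dual R E M\<^esub> f = (\<lambda>x\<in>carrier M. r \<odot>\<^bsub>E\<^esub> f x)"
  by (simp_all add: matlis_dual_def)

lemma dual_map_eq: "g \<in> lin R N E \<Longrightarrow> dual_map R E M N f g = compose (carrier M) g f"
  by (simp add: dual_map_def)

lemma dual_map_apply: "g \<in> lin R N E \<Longrightarrow> x \<in> carrier M \<Longrightarrow> dual_map R E M N f g x = g (f x)"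
  by (simp add: dual_map_def compose_def)

section \<open>The module of forms, evaluation, and annihilators as duals of quotients\<close>

context
  fixes R :: "('a, 'r) ring_scheme" and M :: "('a, 'b) module" and E :: "('a, 'e) module"
  assumes M: "module R M" and E: "module R E"
begin

interpretation M: module R M by (rule M)
interpretation E: module R E by (rule E)

lemma zero_lin: "(\<lambda>x\<in>carrier M. \<zero>\<^bsub>E\<^esub>) \<in> lin R M E"
  by (rule linI) auto

lemma add_lin:
  assumes "f \<in> lin R M E" "g \<in> lin R M E"
  shows "(\<lambda>x\<in>carrier M. f x \<oplus>\<^bsub>E\<^esub> g x) \<in> lin R M E"
  by (rule linI) (auto simp: assms[THEN lin_add] assms[THEN lin_closed] assms[THEN lin_smult]
      E.smult_r_distr E.a_ac)

lemma smult_lin: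
  assumes f: "f \<in> lin R M E" and r: "r \<in> carrier R"
  shows "(\<lambda>x\<in>carrier M. r \<odot>\<^bsub>E\<^esub> f x) \<in> lin R M E"
proof (rule linI)
  show "(\<lambda>x\<in>carrier M. r \<odot>\<^bsub>E\<^esub> f x) (s \<odot>\<^bsub>M\<^esub> x) = s \<odot>\<^bsub>E\<^esub> (\<lambda>x\<in>carrier M. r \<odot>\<^bsub>E\<^esub> f x) x"
    if "s \<in> carrier R" "x \<in> carrier M" for s x
  proof -
    \<comment> \<open>Commutativity of \<open>R\<close> is what makes a scalar multiple of a linear
      map linear.\<close>
    have "r \<odot>\<^bsub>E\<^esub> (s \<odot>\<^bsub>E\<^esub> f x) = s \<odot>\<^bsub>E\<^esub> (r \<odot>\<^bsub>E\<^esub> f x)"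
      using that r lin_closed[OF f] M.m_comm by (simp flip: E.smult_assoc1)
    then show ?thesis
      using that by (simp add: lin_smult[OF f])
  qed
qed (use r in \<open>auto simp: lin_add[OF f] lin_closed[OF f] E.smult_r_distr\<close>)

lemma dual_module: "module R (matlis_dual R E M)"
proof (rule moduleI)
  show "abelian_group (matlis_dual R E M)"
  proof (rule abelian_groupI)
    fix f assume f: "f \<in> carrier (matlis_dual R E M)"
    show "\<exists>g\<in>carrier (matlis_dual R E M). g \<oplus>\<^bsub>matlis_dual R E M\<^esub> f = \<zero>\<^bsub>matlis_dual R E M\<^esub>"
    proof (rule bexI[of _ "\<lambda>x\<in>carrier M. (\<ominus>\<^bsub>R\<^esub> \<one>\<^bsub>R\<^esub>) \<odot>\<^bsub>E\<^esub> f x"])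
      show "(\<lambda>x\<in>carrier M. (\<ominus>\<^bsub>R\<^esub> \<one>\<^bsub>R\<^esub>) \<odot>\<^bsub>E\<^esub> f x) \<oplus>\<^bsub>matlis_dual R E M\<^esub> f = \<zero>\<^bsub>matlis_dual R E M\<^esub>"
        using f by (auto simp: fun_eq_iff restrict_def E.smult_l_minus E.M.l_neg lin_closed)
    qed (use f smult_lin in auto)
    show "\<zero>\<^bsub>matlis_dual R E M\<^esub> \<oplus>\<^bsub>matlis_dual R E M\<^esub> f = f"
      using f by (auto simp: lin_def PiE_iff extensional_def fun_eq_iff)
  qed (auto simp: zero_lin add_lin E.M.a_ac lin_closed intro!: restrict_ext)
  show "\<one>\<^bsub>R\<^esub> \<odot>\<^bsub>matlis_dual R E M\<^esub> f = f" if "f \<in> carrier (matlis_dual R E M)" for f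
    using that by (intro lin_eqI) (auto simp: smult_lin lin_closed)
qed (auto simp: smult_lin E.smult_l_distr E.smult_r_distr E.smult_assoc1 M.is_cring lin_closed
    intro!: restrict_ext)

lemma dual_minus:
  assumes "f \<in> lin R M E" "x \<in> carrier M"
  shows "(\<ominus>\<^bsub>matlis_dual R E M\<^esub> f) x = \<ominus>\<^bsub>E\<^esub> f x"
proof -
  interpret D: module R "matlis_dual R E M" by (rule dual_module)
  have "\<ominus>\<^bsub>matlis_dual R E M\<^esub> f = (\<ominus>\<^bsub>R\<^esub> \<one>\<^bsub>R\<^esub>) \<odot>\<^bsub>matlis_dual R E M\<^esub> f"
    using assms(1) D.smult_l_minus[of "\<one>\<^bsub>R\<^esub>" f] by (simp del: dual_simps(4))
  then show ?thesis
    using assms by (simp add: E.smult_l_minus lin_closed)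
qed

lemma ann_submodule:
  assumes "L \<subseteq> carrier M"
  shows "submodule (ann R E M L) R (matlis_dual R E M)"
proof -
  interpret D: module R "matlis_dual R E M" by (rule dual_module)
  show ?thesis
  proof (rule D.submoduleI)
    show "\<ominus>\<^bsub>matlis_dual R E M\<^esub> f \<in> ann R E M L" if "f \<in> ann R E M L" for f
      using that assms D.a_inv_closed[of f] by (auto simp: ann_def dual_minus)
  qed (use assms in \<open>auto simp: ann_def zero_lin add_lin smult_lin subset_iff\<close>)
qed

lemma coann_submodule:
  assumes "A \<subseteq> lin R M E"
  shows "submodule (coann E M A) R M"
proof -
  have lin: "f \<in> lin R M E" if "f \<in> A" for f using assms that by blast
  show ?thesis
  proof (rule M.submoduleI)
    show "\<zero>\<^bsub>M\<^esub> \<in> coann E M A"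
      using lin[THEN lin_zero[OF M E]] by (intro coannI) simp_all
    have neg: "\<ominus>\<^bsub>E\<^esub> \<zero>\<^bsub>E\<^esub> = \<zero>\<^bsub>E\<^esub>" by (rule E.M.minus_equality) simp_all
    show "\<ominus>\<^bsub>M\<^esub> x \<in> coann E M A" if x: "x \<in> coann E M A" for x
      by (intro coannI)
        (simp_all add: coann_carrier[OF x] coannD[OF x] lin_neg[OF M E lin] neg)
    show "x \<oplus>\<^bsub>M\<^esub> y \<in> coann E M A" if x: "x \<in> coann E M A" and y: "y \<in> coann E M A" for x y
      by (intro coannI) (simp_all add: coann_carrier[OF x] coannD[OF x] coann_carrier[OF y]
          coannD[OF y] lin_add[OF lin])
    show "r \<odot>\<^bsub>M\<^esub> x \<in> coann E M A" if r: "r \<in> carrier R" and x: "x \<in> coann E M A" for r x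
      by (intro coannI) (simp_all add: r coann_carrier[OF x] coannD[OF x] lin_smult[OF lin])
  qed (auto simp: coann_def)
qed

lemma eval_lin: "x \<in> carrier M \<Longrightarrow> eval_map R E M x \<in> lin R (matlis_dual R E M) E"
  by (rule linI) (auto simp: eval_map_def add_lin smult_lin lin_closed)

lemma eval_map_lin: "eval_map R E M \<in> lin R M (matlis_dual R E (matlis_dual R E M))"
proof (rule linI)
  show "eval_map R E M (x \<oplus>\<^bsub>M\<^esub> y) =
      eval_map R E M x \<oplus>\<^bsub>matlis_dual R E (matlis_dual R E M)\<^esub> eval_map R E M y"
    if "x \<in> carrier M" "y \<in> carrier M" for x y
    using that by (auto simp: eval_map_def lin_add intro!: restrict_ext)
  show "eval_map R E M (r \<odot>\<^bsub>M\<^esub> x) =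
      r \<odot>\<^bsub>matlis_dual R E (matlis_dual R E M)\<^esub> eval_map R E M x"
    if "r \<in> carrier R" "x \<in> carrier M" for r x
    using that by (auto simp: eval_map_def lin_smult intro!: restrict_ext)
qed (use eval_lin in auto, simp add: eval_map_def)

text \<open>Forms on \<open>M/L\<close> are the forms on \<open>M\<close> that kill
  \<open>L\<close>: all elements of \<open>L\<close> share the coset of zero, and conversely
  \<open>quot_map_factor\<close> lets a form that kills \<open>L\<close> descend.\<close>

lemma dual_quot_eq:
  assumes L: "submodule L R M"
  shows "dual_quot R E M L = ann R E M L"
proof
  have Lsub: "L \<subseteq> carrier M" by (rule M.submoduleE(1)[OF L])
  show "dual_quot R E M L \<subseteq> ann R E M L"
  proof
    fix f assume "f \<in> dual_quot R E M L"
    then obtain g where g: "g \<in> lin R (quot_module M L) E"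
      and f: "f = compose (carrier M) g (quot_map M L)"
      by (auto simp: dual_quot_def dual_map_eq)
    have zero: "\<zero>\<^bsub>M\<^esub> \<in> L"
      using submodule.axioms(1)[OF L] subgroup.one_closed by force
    have neg: "\<ominus>\<^bsub>M\<^esub> \<zero>\<^bsub>M\<^esub> = \<zero>\<^bsub>M\<^esub>" by (rule M.M.minus_equality) simp_all
    have coset: "L +>\<^bsub>M\<^esub> x = L +>\<^bsub>M\<^esub> \<zero>\<^bsub>M\<^esub>" if "x \<in> L" for x
      using that Lsub quot_map_eq_iff[OF M L, of x "\<zero>\<^bsub>M\<^esub>"] by (simp add: subset_iff neg)
    have flin: "f \<in> lin R M E"
      unfolding f by (rule lin_compose[OF M quot_map_lin[OF M L] g])
    have "f x = f \<zero>\<^bsub>M\<^esub>" if "x \<in> L" for x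
      using that Lsub coset[OF that] by (auto simp: f compose_def quot_map_def)
    then show "f \<in> ann R E M L"
      using flin lin_zero[OF M E flin] by (auto simp: ann_def)
  qed
  show "ann R E M L \<subseteq> dual_quot R E M L"
  proof
    fix f assume f: "f \<in> ann R E M L"
    obtain g where g: "g \<in> lin R (quot_module M L) E"
      "\<And>x. x \<in> carrier M \<Longrightarrow> g (L +>\<^bsub>M\<^esub> x) = f x"
      using quot_map_factor[OF M L E ann_lin[OF f] annD[OF f]] by blast
    have "f = compose (carrier M) g (quot_map M L)"
      using g(2) by (intro lin_eqI[OF ann_lin[OF f] lin_compose[OF M quot_map_lin[OF M L] g(1)]])
        (simp add: compose_def quot_map_def)
    then show "f \<in> dual_quot R E M L"
      using g(1) by (auto simp: dual_quot_def dual_map_eq)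
  qed
qed

end

lemma dual_sub_eq:
  assumes "module R (Und \<C> X)" "module R E" "submodule A R (matlis_dual R E (Und \<C> X))"
  shows "dual_sub R E \<C> A X = coann E (Und \<C> X) A"
proof -
  have "A \<subseteq> lin R (Und \<C> X) E"
    using module.submoduleE(1)[OF dual_module[OF assms(1,2)] assms(3)] by simp
  then show ?thesis
    using eval_lin[OF assms(1,2)]
    by (auto simp: dual_sub_def dual_quot_eq[OF dual_module[OF assms(1,2)] assms(2,3)] ann_def
        coann_def eval_map_def subset_iff)
qed

text \<open>The two evaluation maps cancel: evaluation at \<open>f\<close>, applied to evaluation at
  \<open>x\<close>, is \<open>f x\<close>. The value of \<open>p\<close> has to be a submodule so
  that its image in the double dual is one and \<open>dual_quot_eq\<close> applies there.\<close>

lemma smile_eq: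
  assumes X: "module R (Und \<C> X)" and E: "module R E" and A: "submodule A R (matlis_dual R E (Und \<C> X))"
    and S: "submodule (p (coann E (Und \<C> X) A) X) R (Und \<C> X)"
  shows "smile R E \<C> p A X = ann R E (Und \<C> X) (p (coann E (Und \<C> X) A) X)"
proof -
  let ?M = "Und \<C> X" and ?S = "p (coann E (Und \<C> X) A) X"
  note D = dual_module[OF X E] and DD = dual_module[OF dual_module[OF X E] E]
  have "submodule (eval_map R E ?M ` ?S) R (matlis_dual R E (matlis_dual R E ?M))"
    by (rule submodule_image[OF X DD eval_map_lin[OF X E] S])
  then have *: "dual_quot R E (matlis_dual R E (matlis_dual R E ?M)) (eval_map R E ?M ` ?S) =
      ann R E (matlis_dual R E (matlis_dual R E ?M)) (eval_map R E ?M ` ?S)"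
    by (rule dual_quot_eq[OF DD E])
  have sub: "?S \<subseteq> carrier ?M" by (rule module.submoduleE(1)[OF X S])
  have "eval_map R E (matlis_dual R E ?M) f (eval_map R E ?M x) = f x"
    if "f \<in> lin R ?M E" "x \<in> ?S" for f x
  proof -
    have "x \<in> carrier ?M" using sub that(2) by blast
    then show ?thesis
      using that eval_lin[OF X E] by (simp add: eval_map_def)
  qed
  then show ?thesis
    using eval_lin[OF D E] unfolding smile_def dual_sub_eq[OF X E A] Let_def *
    by (auto simp: ann_def)
qed

section \<open>Injective cogenerators\<close>

lemma (in cring) exists_maximalideal:
  assumes I: "ideal I R" and proper: "I \<noteq> carrier R"
  shows "\<exists>J. maximalideal J R \<and> I \<subseteq> J"
proof -
  \<comment> \<open>Properness is expressed as absence of one, a condition that passes to unions of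
    chains.\<close>
  have one: "\<one> \<notin> J" if "ideal J R" "J \<noteq> carrier R" for J
    using ideal.one_imp_carrier[OF that(1)] that(2) by blast
  let ?A = "{J. ideal J R \<and> J \<noteq> carrier R \<and> I \<subseteq> J}"
  have "\<exists>J\<in>?A. \<forall>X\<in>?A. J \<subseteq> X \<longrightarrow> X = J"
  proof (rule subset_Zorn_nonempty)
    show "?A \<noteq> {}" using assms by blast
    fix \<C> assume C: "\<C> \<noteq> {}" "subset.chain ?A \<C>"
    have sub: "\<C> \<subseteq> ?A" using C(2) by (simp add: subset_chain_def)
    have "subset.chain {J. ideal J R} \<C>"
      using C(2) by (auto simp: subset_chain_def)
    then have "ideal (\<Union>\<C>) R"
      using chain_Union_is_ideal[of \<C>] C(1) by simp
    moreover have "\<one> \<notin> \<Union>\<C>"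
      using sub one by blast
    moreover have "I \<subseteq> \<Union>\<C>"
      using sub C(1) by blast
    ultimately show "\<Union>\<C> \<in> ?A" by auto
  qed
  then obtain J where J: "ideal J R" "J \<noteq> carrier R" "I \<subseteq> J"
    and max: "\<forall>X\<in>?A. J \<subseteq> X \<longrightarrow> X = J" by auto
  have "maximalideal J R"
  proof (rule maximalidealI[OF J(1)])
    show "carrier R \<noteq> J" using J(2) by simp
    show "X = J \<or> X = carrier R" if "ideal X R" "J \<subseteq> X" "X \<subseteq> carrier R" for X
      using max[rule_format, of X] that J(3) by blast
  qed
  then show ?thesis using J(3) by blast
qed

text \<open>The element \<open>e\<close> spans a copy of the residue field of a local ring inside \<open>E\<close>.\<close>

locale injective_cogenerator = cring R for R :: "('a, 'r) ring_scheme" (structure) +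
  fixes E :: "('a, 'e) module"
  assumes injective: "injective_module R E"
    and socle: "\<exists>e\<in>carrier E. e \<noteq> \<zero>\<^bsub>E\<^esub> \<and>
      (\<forall>I. ideal I R \<and> I \<noteq> carrier R \<longrightarrow> (\<forall>r\<in>I. r \<odot>\<^bsub>E\<^esub> e = \<zero>\<^bsub>E\<^esub>))"

text \<open>The witness for \<open>socle\<close> is the image of the class of one under the
  embedding of the residue field. A proper ideal lies in some maximal ideal, hence in \<mm>, and
  \<mm> kills the residue field.\<close>

lemma injective_cogenerator_hull:
  fixes R (structure)
  assumes R: "complete_local_ring R \<mm>" and E: "injective_hull R (residue_field R \<mm>) E"
  shows "injective_cogenerator R E"
proof -
  interpret complete_local_ring R \<mm> by (rule R)
  interpret \<mm>: maximalideal \<mm> R by (rule maximal)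
  let ?M = "regular_module R" and ?c = "\<lambda>x. \<mm> +>\<^bsub>regular_module R\<^esub> x"
  have M: "module R ?M" by (rule regular_module)
  have L: "submodule \<mm> R ?M" by (rule ideal_submodule[OF \<mm>.is_ideal])
  interpret M: module R ?M by (rule M)
  have [simp]: "carrier ?M = carrier R" "\<zero>\<^bsub>?M\<^esub> = \<zero>" "r \<odot>\<^bsub>?M\<^esub> x = r \<otimes> x" "x \<oplus>\<^bsub>?M\<^esub> y = x \<oplus> y" for r x y
    by (simp_all add: regular_module_def)
  have neg: "\<ominus>\<^bsub>?M\<^esub> \<zero> = \<zero>"
    by (rule M.M.minus_equality[of "\<zero>" "\<zero>", simplified])
  have coset: "?c x = ?c \<zero> \<longleftrightarrow> x \<in> \<mm>" if "x \<in> carrier R" for x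
    using quot_map_eq_iff[OF M L, of x \<zero>] that by (simp add: neg)
  have inj: "injective_module R E" using E by (simp add: injective_hull_def)
  interpret E: module R E using inj by (simp add: injective_module_def)
  obtain \<iota> where \<iota>: "\<iota> \<in> lin R (quot_module ?M \<mm>) E" "inj_on \<iota> (carrier (quot_module ?M \<mm>))"
    using E unfolding injective_hull_def residue_field_def by blast
  have carr: "?c x \<in> carrier (quot_module ?M \<mm>)" if "x \<in> carrier R" for x
    using that carrier_quot[OF M L] by auto
  have smult: "r \<odot>\<^bsub>E\<^esub> \<iota> (?c \<one>) = \<iota> (?c r)" if "r \<in> carrier R" for r
    using lin_smult[OF \<iota>(1) that carr[of \<one>]] smult_quot[OF M L that, of \<one>] that by simp
  have \<iota>E: "\<iota> (?c \<one>) \<in> carrier E" by (rule lin_closed[OF \<iota>(1) carr]) simp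
  have zero: "\<iota> (?c \<zero>) = \<zero>\<^bsub>E\<^esub>"
    using smult[of \<zero>] \<iota>E by simp
  have "\<one> \<notin> \<mm>" using \<mm>.I_notcarr \<mm>.one_imp_carrier by blast
  then have "?c \<one> \<noteq> ?c \<zero>" using coset by simp
  then have "\<iota> (?c \<one>) \<noteq> \<zero>\<^bsub>E\<^esub>"
    using inj_onD[OF \<iota>(2), of "?c \<one>" "?c \<zero>"] carr zero by auto
  moreover have "r \<odot>\<^bsub>E\<^esub> \<iota> (?c \<one>) = \<zero>\<^bsub>E\<^esub>" if I: "ideal I R" "I \<noteq> carrier R" and r: "r \<in> I" for I r
  proof -
    obtain J where "maximalideal J R" "I \<subseteq> J" using exists_maximalideal[OF I] by blast
    then have "r \<in> \<mm>" using local r by blast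
    moreover have "r \<in> carrier R" using ideal.Icarr[OF I(1) r] .
    ultimately have "?c r = ?c \<zero>" "r \<odot>\<^bsub>E\<^esub> \<iota> (?c \<one>) = \<iota> (?c r)"
      using coset smult by blast+
    then show ?thesis using zero by simp
  qed
  ultimately show ?thesis
    using inj \<iota>E by unfold_locales blast+
qed

context injective_cogenerator
begin

lemma module_E: "module R E"
  using injective by (simp add: injective_module_def)

text \<open>Apply \<open>partial_lin_extend\<close> to the partial map which sends \<open>h x + s\<close> to \<open>b x\<close>.\<close>

lemma extend_along:
  assumes B: "module R B" and M: "module R M" and h: "h \<in> lin R B M" and b: "b \<in> lin R B E"
    and S: "submodule S R M" and ker: "\<And>x. x \<in> carrier B \<Longrightarrow> h x \<in> S \<Longrightarrow> b x = \<zero>\<^bsub>E\<^esub>"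
  shows "\<exists>c\<in>ann R E M S. \<forall>x\<in>carrier B. c (h x) = b x"
proof -
  interpret B: module R B by (rule B)
  interpret M: module R M by (rule M)
  interpret E: module R E by (rule module_E)
  note SE = M.submoduleE[OF S]
  have S0: "\<zero>\<^bsub>M\<^esub> \<in> S"
    using submodule.axioms(1)[OF S] subgroup.one_closed by force
  have Sc: "s \<in> carrier M" if "s \<in> S" for s using SE(1) that by blast
  note hc = lin_closed[OF h] and bc = lin_closed[OF b]
  define G where "G = (\<lambda>(x, s). (h x \<oplus>\<^bsub>M\<^esub> s, b x)) ` (carrier B \<times> S)"
  have GI: "(h x \<oplus>\<^bsub>M\<^esub> s, b x) \<in> G" if "x \<in> carrier B" "s \<in> S" for x s
    using that by (force simp: G_def)
  have GE: "\<exists>x s. x \<in> carrier B \<and> s \<in> S \<and> u = h x \<oplus>\<^bsub>M\<^esub> s \<and> a = b x" if "(u, a) \<in> G" for u a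
    using that by (auto simp: G_def)
  have "partial_lin R M E G"
    unfolding partial_lin_def
  proof (intro conjI allI impI; (elim conjE)?)
    show "G \<subseteq> carrier M \<times> carrier E"
      using hc bc Sc by (auto simp: G_def)
    show "(\<zero>\<^bsub>M\<^esub>, \<zero>\<^bsub>E\<^esub>) \<in> G"
      using GI[OF B.M.zero_closed S0] by (simp add: lin_zero[OF B M h] lin_zero[OF B module_E b])
    show "(u \<oplus>\<^bsub>M\<^esub> v, a \<oplus>\<^bsub>E\<^esub> c) \<in> G" if ua: "(u, a) \<in> G" and vc: "(v, c) \<in> G" for u a v c
    proof -
      obtain x s where x: "x \<in> carrier B" "s \<in> S" "u = h x \<oplus>\<^bsub>M\<^esub> s" "a = b x" using GE[OF ua] by blast
      obtain y t where y: "y \<in> carrier B" "t \<in> S" "v = h y \<oplus>\<^bsub>M\<^esub> t" "c = b y" using GE[OF vc] by blast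
      have "u \<oplus>\<^bsub>M\<^esub> v = h (x \<oplus>\<^bsub>B\<^esub> y) \<oplus>\<^bsub>M\<^esub> (s \<oplus>\<^bsub>M\<^esub> t)"
        using x y hc Sc by (simp add: lin_add[OF h] M.M.a_ac)
      then show ?thesis
        using GI[of "x \<oplus>\<^bsub>B\<^esub> y" "s \<oplus>\<^bsub>M\<^esub> t"] x y SE(5) by (simp add: lin_add[OF b])
    qed
    show "(r \<odot>\<^bsub>M\<^esub> u, r \<odot>\<^bsub>E\<^esub> a) \<in> G" if r: "r \<in> carrier R" and ua: "(u, a) \<in> G" for r u a
    proof -
      obtain x s where x: "x \<in> carrier B" "s \<in> S" "u = h x \<oplus>\<^bsub>M\<^esub> s" "a = b x" using GE[OF ua] by blast
      have "r \<odot>\<^bsub>M\<^esub> u = h (r \<odot>\<^bsub>B\<^esub> x) \<oplus>\<^bsub>M\<^esub> (r \<odot>\<^bsub>M\<^esub> s)"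
        using x r hc Sc by (simp add: lin_smult[OF h] M.smult_r_distr)
      then show ?thesis
        using GI[of "r \<odot>\<^bsub>B\<^esub> x" "r \<odot>\<^bsub>M\<^esub> s"] x r SE(4) by (simp add: lin_smult[OF b])
    qed
    \<comment> \<open>Here the formula is seen to be well defined: if \<open>h x\<close> and
      \<open>s\<close> cancel, then \<open>h x\<close> lies in \<open>S\<close>, and
      \<open>ker\<close> gives \<open>b x\<close> zero.\<close>
    show "a = \<zero>\<^bsub>E\<^esub>" if za: "(\<zero>\<^bsub>M\<^esub>, a) \<in> G" for a
    proof -
      obtain x s where x: "x \<in> carrier B" "s \<in> S" "\<zero>\<^bsub>M\<^esub> = h x \<oplus>\<^bsub>M\<^esub> s" "a = b x" using GE[OF za] by blast
      have "\<ominus>\<^bsub>M\<^esub> s = h x"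
        using x hc Sc by (intro M.M.minus_equality) simp_all
      then have "h x \<in> S" using SE(3)[OF x(2)] by simp
      then show ?thesis using ker x by simp
    qed
  qed
  then obtain c where c: "c \<in> lin R M E" "\<And>u a. (u, a) \<in> G \<Longrightarrow> c u = a"
    using partial_lin_extend[OF injective M] by fast
  show ?thesis
  proof (intro bexI ballI)
    show "c (h x) = b x" if "x \<in> carrier B" for x
      using c(2)[OF GI[OF that S0]] hc[OF that] by simp
    have "c s = \<zero>\<^bsub>E\<^esub>" if "s \<in> S" for s
      using c(2)[OF GI[OF B.M.zero_closed that]] Sc[OF that]
      by (simp add: lin_zero[OF B M h] lin_zero[OF B module_E b])
    then show "c \<in> ann R E M S" using c(1) by (simp add: ann_def)
  qed
qed

text \<open>The cyclic module generated by \<open>x\<close> modulo \<open>L\<close> maps onto the residue field, hence to \<open>E\<close>.\<close>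

lemma separate:
  assumes M: "module R M" and L: "submodule L R M" and x: "x \<in> carrier M" "x \<notin> L"
  shows "\<exists>f\<in>ann R E M L. f x \<noteq> \<zero>\<^bsub>E\<^esub>"
proof -
  interpret M: module R M by (rule M)
  interpret E: module R E by (rule module_E)
  let ?B = "regular_module R"
  have B: "module R ?B" by (rule regular_module)
  have [simp]: "carrier ?B = carrier R" "\<zero>\<^bsub>?B\<^esub> = \<zero>" "r \<odot>\<^bsub>?B\<^esub> y = r \<otimes> y" "y \<oplus>\<^bsub>?B\<^esub> z = y \<oplus> z" for r y z
    by (simp_all add: regular_module_def)
  obtain e where e: "e \<in> carrier E" "e \<noteq> \<zero>\<^bsub>E\<^esub>"
    "\<And>I r. \<lbrakk>ideal I R; I \<noteq> carrier R; r \<in> I\<rbrakk> \<Longrightarrow> r \<odot>\<^bsub>E\<^esub> e = \<zero>\<^bsub>E\<^esub>"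
    using socle by blast
  have h: "(\<lambda>r\<in>carrier R. r \<odot>\<^bsub>M\<^esub> x) \<in> lin R ?B M"
    by (rule linI) (use x in \<open>auto simp: M.smult_l_distr M.smult_assoc1\<close>)
  have b: "(\<lambda>r\<in>carrier R. r \<odot>\<^bsub>E\<^esub> e) \<in> lin R ?B E"
    by (rule linI) (use e in \<open>auto simp: E.smult_l_distr E.smult_assoc1\<close>)
  \<comment> \<open>The colon ideal of \<open>L\<close> and \<open>x\<close>. As \<open>x\<close> is
    not in \<open>L\<close> it is proper, so by \<open>socle\<close> it kills \<open>e\<close>; this
    is the compatibility that \<open>extend_along\<close> requires of multiplication into
    \<open>x\<close> and into \<open>e\<close>.\<close>
  define I where "I = {r \<in> carrier R. r \<odot>\<^bsub>M\<^esub> x \<in> L}"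
  note LE = M.submoduleE[OF L]
  have L0: "\<zero>\<^bsub>M\<^esub> \<in> L"
    using submodule.axioms(1)[OF L] subgroup.one_closed by force
  have I: "ideal I R"
  proof (rule idealI)
    show "subgroup I (add_monoid R)"
    proof (rule add.subgroupI)
      show "I \<subseteq> carrier R" by (auto simp: I_def)
      have "\<zero> \<in> I" using L0 x by (simp add: I_def)
      then show "I \<noteq> {}" by blast
      show "\<ominus> r \<in> I" if "r \<in> I" for r
        using that x LE(3) by (simp add: I_def M.smult_l_minus)
      show "r \<oplus> s \<in> I" if "r \<in> I" "s \<in> I" for r s
        using that x LE(5) by (simp add: I_def M.smult_l_distr)
    qed
    show "s \<otimes> r \<in> I" if "r \<in> I" "s \<in> carrier R" for r s
      using that x LE(4) by (simp add: I_def M.smult_assoc1)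
    then show "r \<otimes> s \<in> I" if "r \<in> I" "s \<in> carrier R" for r s
      using that m_comm[of r s] by (simp add: I_def)
  qed (rule ring_axioms)
  have "\<one> \<notin> I" using x by (simp add: I_def)
  then have proper: "I \<noteq> carrier R" by auto
  have "\<exists>c\<in>ann R E M L. \<forall>r\<in>carrier ?B. c ((\<lambda>r\<in>carrier R. r \<odot>\<^bsub>M\<^esub> x) r) = (\<lambda>r\<in>carrier R. r \<odot>\<^bsub>E\<^esub> e) r"
  proof (rule extend_along[OF B M h b L])
    show "(\<lambda>r\<in>carrier R. r \<odot>\<^bsub>E\<^esub> e) r = \<zero>\<^bsub>E\<^esub>"
      if "r \<in> carrier ?B" "(\<lambda>r\<in>carrier R. r \<odot>\<^bsub>M\<^esub> x) r \<in> L" for r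
      using that e(3)[OF I proper, of r] by (simp add: I_def)
  qed
  then obtain c where c: "c \<in> ann R E M L" "\<forall>r\<in>carrier R. c (r \<odot>\<^bsub>M\<^esub> x) = r \<odot>\<^bsub>E\<^esub> e" by auto
  have "c x = e" using c(2)[rule_format, OF one_closed] x e(1) by simp
  then show ?thesis using c(1) e(2) by blast
qed

lemma coann_ann:
  assumes M: "module R M" and L: "submodule L R M"
  shows "coann E M (ann R E M L) = L"
proof
  have "L \<subseteq> carrier M" by (rule module.submoduleE(1)[OF M L])
  then show "L \<subseteq> coann E M (ann R E M L)"
    by (auto simp: coann_def ann_def)
  show "coann E M (ann R E M L) \<subseteq> L"
    using separate[OF M L] by (auto simp: coann_def)
qed

text \<open>The difference of \<open>x\<close> and \<open>y\<close> is separated from the zero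
  submodule. This makes duality faithful on morphisms.\<close>

lemma eq_if_all_eq:
  assumes M: "module R M" and xy: "x \<in> carrier M" "y \<in> carrier M"
    and eq: "\<And>f. f \<in> lin R M E \<Longrightarrow> f x = f y"
  shows "x = y"
proof (rule ccontr)
  interpret M: module R M by (rule M)
  interpret E: module R E by (rule module_E)
  assume neq: "x \<noteq> y"
  have "x \<oplus>\<^bsub>M\<^esub> \<ominus>\<^bsub>M\<^esub> y \<notin> {\<zero>\<^bsub>M\<^esub>}"
  proof
    assume "x \<oplus>\<^bsub>M\<^esub> \<ominus>\<^bsub>M\<^esub> y \<in> {\<zero>\<^bsub>M\<^esub>}"
    then have "\<ominus>\<^bsub>M\<^esub> (\<ominus>\<^bsub>M\<^esub> y) = x" using xy by (intro M.M.minus_equality) simp_all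
    then show False using neq xy by simp
  qed
  then obtain f where f: "f \<in> lin R M E" "f (x \<oplus>\<^bsub>M\<^esub> \<ominus>\<^bsub>M\<^esub> y) \<noteq> \<zero>\<^bsub>E\<^esub>"
    using separate[OF M zero_submodule[OF M], of "x \<oplus>\<^bsub>M\<^esub> \<ominus>\<^bsub>M\<^esub> y"] xy by (auto simp: ann_def)
  have "f (x \<oplus>\<^bsub>M\<^esub> \<ominus>\<^bsub>M\<^esub> y) = f y \<oplus>\<^bsub>E\<^esub> \<ominus>\<^bsub>E\<^esub> f y"
    using xy eq[OF f(1)] by (simp add: lin_add[OF f(1)] lin_neg[OF M module_E f(1)])
  then show False
    using f lin_closed[OF f(1) xy(2)] by (simp add: E.M.r_neg)
qed

end

section \<open>The dual category\<close>

text \<open>A form that kills the kernel of \<open>k\<close> is a form on the image of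
  \<open>k\<close>, and injectivity of \<open>E\<close> extends it to \<open>N\<close>. This is
  \<open>extend_along\<close> with the zero submodule.\<close>

lemma (in injective_cogenerator) image_dual_map:
  assumes M: "module R M" and N: "module R N" and k: "k \<in> lin R M N"
  shows "dual_map R E M N k ` lin R N E = ann R E M {x \<in> carrier M. k x = \<zero>\<^bsub>N\<^esub>}"
proof
  show "dual_map R E M N k ` lin R N E \<subseteq> ann R E M {x \<in> carrier M. k x = \<zero>\<^bsub>N\<^esub>}"
    using lin_zero[OF N module_E] by (auto simp: ann_def dual_map_eq compose_def lin_compose[OF M k, unfolded compose_def])
  show "ann R E M {x \<in> carrier M. k x = \<zero>\<^bsub>N\<^esub>} \<subseteq> dual_map R E M N k ` lin R N E"
  proof
    fix f assume f: "f \<in> ann R E M {x \<in> carrier M. k x = \<zero>\<^bsub>N\<^esub>}"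
    obtain c where c: "c \<in> lin R N E" "\<forall>x\<in>carrier M. c (k x) = f x"
      using extend_along[OF M N k ann_lin[OF f] zero_submodule[OF N]] annD[OF f]
      by (auto simp: ann_def)
    have "f = dual_map R E M N k c"
      unfolding dual_map_eq[OF c(1)]
      by (rule lin_eqI[OF ann_lin[OF f] lin_compose[OF M k c(1)]]) (use c(2) in \<open>simp add: compose_def\<close>)
    then show "f \<in> dual_map R E M N k ` lin R N E" using c(1) by blast
  qed
qed

lemma dual_cat_simps [simp]:
  "Obj (dual_cat R E \<C>) = Obj \<C>"
  "Und (dual_cat R E \<C>) X = matlis_dual R E (Und \<C> X)"
  "Mor (dual_cat R E \<C>) X Y = dual_map R E (Und \<C> Y) (Und \<C> X) ` Mor \<C> Y X"
  by (simp_all add: dual_cat_def)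

locale dual_modcat = abelian_modcat R \<C> + injective_cogenerator R E
  for R :: "('a, 'r) ring_scheme" (structure) and \<C> :: "('a, 'b, 'o) modcat" and E :: "('a, 'e) module"
begin

abbreviation "\<D> \<equiv> dual_cat R E \<C>"
abbreviation "dual X Y f \<equiv> dual_map R E (Und \<C> X) (Und \<C> Y) f"
abbreviation "Ann X L \<equiv> ann R E (Und \<C> X) L"
abbreviation "Coann X A \<equiv> coann E (Und \<C> X) A"
abbreviation "forms X \<equiv> lin R (Und \<C> X) E"
abbreviation "Ker X Y f \<equiv> {x \<in> elts \<C> X. f x = null \<C> Y}"

section \<open>Duals of morphisms and of commuting triangles\<close>

lemma mor_lin: "\<lbrakk>X \<in> Obj \<C>; Y \<in> Obj \<C>; f \<in> Mor \<C> X Y\<rbrakk> \<Longrightarrow> f \<in> lin R (Und \<C> X) (Und \<C> Y)"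
  using Mor_lin by blast

lemma mor_closed: "\<lbrakk>X \<in> Obj \<C>; Y \<in> Obj \<C>; f \<in> Mor \<C> X Y; x \<in> elts \<C> X\<rbrakk> \<Longrightarrow> f x \<in> elts \<C> Y"
  using lin_closed[OF mor_lin] .

lemma dual_form:
  "\<lbrakk>X \<in> Obj \<C>; Y \<in> Obj \<C>; f \<in> Mor \<C> X Y; g \<in> forms Y\<rbrakk> \<Longrightarrow> dual X Y f g \<in> forms X"
  by (simp add: dual_map_eq lin_compose[OF Und_module mor_lin])

lemma form_eqI:
  assumes "X \<in> Obj \<C>" "x \<in> elts \<C> X" "y \<in> elts \<C> X" "\<And>f. f \<in> forms X \<Longrightarrow> f x = f y"
  shows "x = y"
  using eq_if_all_eq[OF Und_module] assms by blast

lemma ker_submodule: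
  assumes "X \<in> Obj \<C>" "Y \<in> Obj \<C>" "f \<in> Mor \<C> X Y"
  shows "submodule (Ker X Y f) R (Und \<C> X)"
  using submodule_pre[OF Und_module Und_module mor_lin zero_submodule[OF Und_module]] assms by simp

lemma image_submodule:
  assumes "X \<in> Obj \<C>" "Y \<in> Obj \<C>" "f \<in> Mor \<C> X Y"
  shows "submodule (f ` elts \<C> X) R (Und \<C> Y)"
  using submodule_image[OF Und_module Und_module mor_lin module.carrier_is_submodule[OF Und_module]]
    assms by blast

text \<open>If \<open>f\<close> misses \<open>y\<close>, some form vanishes on the image of
  \<open>f\<close> but not at \<open>y\<close>; its dual image is that of the zero form, so the dual
  map is not injective.\<close>

lemma inj_mor_dual_iff:
  assumes X: "X \<in> Obj \<C>" and Y: "Y \<in> Obj \<C>" and f: "f \<in> Mor \<C> X Y"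
  shows "inj_mor \<D> Y X (dual X Y f) \<longleftrightarrow> surj_mor \<C> X Y f"
proof
  assume "inj_mor \<D> Y X (dual X Y f)"
  then have inj: "inj_on (dual X Y f) (forms Y)" by (simp add: inj_mor_def)
  have "elts \<C> Y \<subseteq> f ` elts \<C> X"
  proof (rule subsetI, rule ccontr)
    fix y assume y: "y \<in> elts \<C> Y" "y \<notin> f ` elts \<C> X"
    obtain c where c: "c \<in> Ann Y (f ` elts \<C> X)" "c y \<noteq> \<zero>\<^bsub>E\<^esub>"
      using separate[OF Und_module[OF Y] image_submodule[OF X Y f] y] by blast
    let ?z = "\<lambda>y\<in>elts \<C> Y. \<zero>\<^bsub>E\<^esub>"
    have z: "?z \<in> forms Y" by (rule zero_lin[OF Und_module[OF Y] module_E])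
    have "dual X Y f c = dual X Y f ?z"
    proof (rule lin_eqI[OF dual_form[OF X Y f ann_lin[OF c(1)]] dual_form[OF X Y f z]])
      fix x assume x: "x \<in> elts \<C> X"
      then show "dual X Y f c x = dual X Y f ?z x"
        using annD[OF c(1), of "f x"] mor_closed[OF X Y f x]
        by (simp add: dual_map_apply[OF ann_lin[OF c(1)]] dual_map_apply[OF z])
    qed
    then have "c = ?z" using inj_onD[OF inj] ann_lin[OF c(1)] z by blast
    then show False using c(2) y(1) by simp
  qed
  then show "surj_mor \<C> X Y f"
    unfolding surj_mor_def using X Y f mor_closed[OF X Y f] by blast
next
  assume "surj_mor \<C> X Y f"
  then have surj: "f ` elts \<C> X = elts \<C> Y" by (simp add: surj_mor_def)
  have "inj_on (dual X Y f) (forms Y)"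
  proof (rule inj_onI)
    fix g h assume gh: "g \<in> forms Y" "h \<in> forms Y" "dual X Y f g = dual X Y f h"
    have "g (f x) = h (f x)" if "x \<in> elts \<C> X" for x
      using fun_cong[OF gh(3), of x] gh(1,2) that by (simp add: dual_map_apply)
    then have "g y = h y" if "y \<in> elts \<C> Y" for y
      using that unfolding surj[symmetric] by blast
    then show "g = h" by (rule lin_eqI[OF gh(1,2)])
  qed
  then show "inj_mor \<D> Y X (dual X Y f)"
    using X Y f by (simp add: inj_mor_def)
qed

text \<open>If all forms on \<open>X\<close> come from \<open>Y\<close>, they cannot distinguish
  points with equal image, yet forms separate points. Conversely every form kills a zero kernel, and
  \<open>image_dual_map\<close> shows that it is attained.\<close>

lemma surj_mor_dual_iff:
  assumes X: "X \<in> Obj \<C>" and Y: "Y \<in> Obj \<C>" and f: "f \<in> Mor \<C> X Y"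
  shows "surj_mor \<D> Y X (dual X Y f) \<longleftrightarrow> inj_mor \<C> X Y f"
proof
  assume "surj_mor \<D> Y X (dual X Y f)"
  then have surj: "dual X Y f ` forms Y = forms X" by (simp add: surj_mor_def)
  have "inj_on f (elts \<C> X)"
  proof (rule inj_onI)
    fix x y assume xy: "x \<in> elts \<C> X" "y \<in> elts \<C> X" "f x = f y"
    show "x = y"
    proof (rule form_eqI[OF X xy(1,2)])
      fix g assume "g \<in> forms X"
      then obtain h where "h \<in> forms Y" "g = dual X Y f h" using surj by blast
      then show "g x = g y" using xy by (simp add: dual_map_apply)
    qed
  qed
  then show "inj_mor \<C> X Y f" using X Y f by (simp add: inj_mor_def)
next
  assume "inj_mor \<C> X Y f"
  then have inj: "inj_on f (elts \<C> X)" by (simp add: inj_mor_def)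
  interpret X: module R "Und \<C> X" by (rule Und_module[OF X])
  have "x = null \<C> X" if "x \<in> Ker X Y f" for x
    using that inj_onD[OF inj, of x "null \<C> X"] lin_zero[OF Und_module[OF X] Und_module[OF Y] mor_lin[OF X Y f]]
    by simp
  then have "g \<in> Ann X (Ker X Y f)" if "g \<in> forms X" for g
    using that lin_zero[OF Und_module[OF X] module_E that] by (auto simp: ann_def)
  then have "dual X Y f ` forms Y = forms X"
    unfolding image_dual_map[OF Und_module[OF X] Und_module[OF Y] mor_lin[OF X Y f]]
    using ann_lin by blast
  then show "surj_mor \<D> Y X (dual X Y f)"
    using X Y f by (simp add: surj_mor_def)
qed

text \<open>Evaluating both sides gives forms on \<open>Z\<close> at \<open>g (f x)\<close> and at
  \<open>h x\<close>, and forms separate points. The equivalence carries solutions of lifting and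
  extension problems in both directions.\<close>

lemma dual_comp_eq_iff:
  assumes X: "X \<in> Obj \<C>" and Y: "Y \<in> Obj \<C>" and Z: "Z \<in> Obj \<C>"
    and f: "f \<in> Mor \<C> X Y" and g: "g \<in> Mor \<C> Y Z" and h: "h \<in> Mor \<C> X Z"
  shows "(\<forall>c\<in>forms Z. dual X Y f (dual Y Z g c) = dual X Z h c) \<longleftrightarrow>
    (\<forall>x\<in>elts \<C> X. g (f x) = h x)"
proof -
  have l: "dual X Y f (dual Y Z g c) x = c (g (f x))" if "c \<in> forms Z" "x \<in> elts \<C> X" for c x
    using that dual_form[OF Y Z g] mor_closed[OF X Y f] by (simp add: dual_map_apply)
  have r: "dual X Z h c x = c (h x)" if "c \<in> forms Z" "x \<in> elts \<C> X" for c x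
    using that by (simp add: dual_map_apply)
  show ?thesis
  proof
    assume eq: "\<forall>c\<in>forms Z. dual X Y f (dual Y Z g c) = dual X Z h c"
    show "\<forall>x\<in>elts \<C> X. g (f x) = h x"
    proof
      fix x assume x: "x \<in> elts \<C> X"
      show "g (f x) = h x"
      proof (rule form_eqI[OF Z])
        show "g (f x) \<in> elts \<C> Z" "h x \<in> elts \<C> Z"
          using x by (auto intro: mor_closed[OF Y Z g] mor_closed[OF X Y f] mor_closed[OF X Z h])
        show "c (g (f x)) = c (h x)" if "c \<in> forms Z" for c
          using that x eq l[of c x] r[of c x] by simp
      qed
    qed
  next
    assume "\<forall>x\<in>elts \<C> X. g (f x) = h x"
    then show "\<forall>c\<in>forms Z. dual X Y f (dual Y Z g c) = dual X Z h c"
      by (intro ballI lin_eqI[OF dual_form[OF X Y f dual_form[OF Y Z g]] dual_form[OF X Z h]])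
        (simp_all add: l r)
  qed
qed

text \<open>Every extension problem in the dual category is the dual of a lifting problem in \<C>,
  and a solution of one dualises to a solution of the other by
  \<open>dual_comp_eq_iff\<close>.\<close>

lemma injective_obj_dual_iff: "injective_obj \<D> P \<longleftrightarrow> projective_obj \<C> P"
proof
  assume proj: "projective_obj \<C> P"
  then have P: "P \<in> Obj \<C>" by (simp add: projective_obj_def)
  show "injective_obj \<D> P"
    unfolding injective_obj_def
  proof (intro conjI allI impI; (elim conjE)?)
    show "P \<in> Obj \<D>" using P by simp
    fix Y Z g' f' assume g': "inj_mor \<D> Y Z g'" and f': "f' \<in> Mor \<D> Y P"
    have obj: "Y \<in> Obj \<C>" "Z \<in> Obj \<C>" using g' by (simp_all add: inj_mor_def)
    obtain g where g: "g \<in> Mor \<C> Z Y" "g' = dual Z Y g" using g' by (auto simp: inj_mor_def)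
    obtain f where f: "f \<in> Mor \<C> P Y" "f' = dual P Y f" using f' by auto
    have "surj_mor \<C> Z Y g" using g' g(2) inj_mor_dual_iff[OF obj(2,1) g(1)] by simp
    then obtain h where h: "h \<in> Mor \<C> P Z" "\<forall>x\<in>elts \<C> P. g (h x) = f x"
      using proj f(1) unfolding projective_obj_def by blast
    have "dual P Z h (dual Z Y g c) = dual P Y f c" if "c \<in> forms Y" for c
      using dual_comp_eq_iff[OF P obj(2,1) h(1) g(1) f(1)] h(2) that by blast
    then show "\<exists>h\<in>Mor \<D> Z P. \<forall>y\<in>elts \<D> Y. h (g' y) = f' y"
      using h(1) g(2) f(2) by auto
  qed
next
  assume inj: "injective_obj \<D> P"
  then have P: "P \<in> Obj \<C>" by (simp add: injective_obj_def)
  show "projective_obj \<C> P"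
    unfolding projective_obj_def
  proof (intro conjI allI impI; (elim conjE)?)
    show "P \<in> Obj \<C>" by (rule P)
    fix Y Z g f assume g: "surj_mor \<C> Y Z g" and f: "f \<in> Mor \<C> P Z"
    have obj: "Y \<in> Obj \<C>" "Z \<in> Obj \<C>" and gm: "g \<in> Mor \<C> Y Z" using g by (simp_all add: surj_mor_def)
    have "inj_mor \<D> Z Y (dual Y Z g)" using g inj_mor_dual_iff[OF obj gm] by simp
    moreover have "dual P Z f \<in> Mor \<D> Z P" using f by simp
    ultimately have "\<exists>h\<in>Mor \<D> Y P. \<forall>c\<in>elts \<D> Z. h (dual Y Z g c) = dual P Z f c"
      using inj unfolding injective_obj_def by blast
    then obtain h where h: "h \<in> Mor \<C> P Y" "\<forall>c\<in>forms Z. dual P Y h (dual Y Z g c) = dual P Z f c"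
      by auto
    then show "\<exists>h\<in>Mor \<C> P Y. \<forall>x\<in>elts \<C> P. g (h x) = f x"
      using dual_comp_eq_iff[OF P obj h(1) gm f] by blast
  qed
qed

lemma projective_obj_dual_iff: "projective_obj \<D> I \<longleftrightarrow> injective_obj \<C> I"
proof
  assume inj: "injective_obj \<C> I"
  then have I: "I \<in> Obj \<C>" by (simp add: injective_obj_def)
  show "projective_obj \<D> I"
    unfolding projective_obj_def
  proof (intro conjI allI impI; (elim conjE)?)
    show "I \<in> Obj \<D>" using I by simp
    fix Y Z g' f' assume g': "surj_mor \<D> Y Z g'" and f': "f' \<in> Mor \<D> I Z"
    have obj: "Y \<in> Obj \<C>" "Z \<in> Obj \<C>" using g' by (simp_all add: surj_mor_def)
    obtain g where g: "g \<in> Mor \<C> Z Y" "g' = dual Z Y g" using g' by (auto simp: surj_mor_def)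
    obtain f where f: "f \<in> Mor \<C> Z I" "f' = dual Z I f" using f' by auto
    have "inj_mor \<C> Z Y g" using g' g(2) surj_mor_dual_iff[OF obj(2,1) g(1)] by simp
    then obtain h where h: "h \<in> Mor \<C> Y I" "\<forall>x\<in>elts \<C> Z. h (g x) = f x"
      using inj f(1) unfolding injective_obj_def by blast
    have "dual Z Y g (dual Y I h c) = dual Z I f c" if "c \<in> forms I" for c
      using dual_comp_eq_iff[OF obj(2,1) I g(1) h(1) f(1)] h(2) that by blast
    then show "\<exists>h\<in>Mor \<D> I Y. \<forall>x\<in>elts \<D> I. g' (h x) = f' x"
      using h(1) g(2) f(2) by auto
  qed
next
  assume proj: "projective_obj \<D> I"
  then have I: "I \<in> Obj \<C>" by (simp add: projective_obj_def)
  show "injective_obj \<C> I"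
    unfolding injective_obj_def
  proof (intro conjI allI impI; (elim conjE)?)
    show "I \<in> Obj \<C>" by (rule I)
    fix Y Z g f assume g: "inj_mor \<C> Y Z g" and f: "f \<in> Mor \<C> Y I"
    have obj: "Y \<in> Obj \<C>" "Z \<in> Obj \<C>" and gm: "g \<in> Mor \<C> Y Z" using g by (simp_all add: inj_mor_def)
    have "surj_mor \<D> Z Y (dual Y Z g)" using g surj_mor_dual_iff[OF obj gm] by simp
    moreover have "dual Y I f \<in> Mor \<D> I Y" using f by simp
    ultimately have "\<exists>h\<in>Mor \<D> I Z. \<forall>c\<in>elts \<D> I. dual Y Z g (h c) = dual Y I f c"
      using proj unfolding projective_obj_def by blast
    then obtain h where h: "h \<in> Mor \<C> Z I" "\<forall>c\<in>forms I. dual Y Z g (dual Z I h c) = dual Y I f c"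
      by auto
    then show "\<exists>h\<in>Mor \<C> Z I. \<forall>y\<in>elts \<C> Y. h (g y) = f y"
      using dual_comp_eq_iff[OF obj I gm h(1) f] by blast
  qed
qed

section \<open>Subobjects and pairs in the dual category\<close>

lemma subobject_dual_iff:
  "subobject \<D> X A \<longleftrightarrow> (\<exists>K k. surj_mor \<C> X K k \<and> A = Ann X (Ker X K k))"
proof
  assume "subobject \<D> X A"
  then obtain K k' where k': "inj_mor \<D> K X k'" "A = k' ` forms K" by (auto simp: subobject_def)
  then obtain k where k: "X \<in> Obj \<C>" "K \<in> Obj \<C>" "k \<in> Mor \<C> X K" "k' = dual X K k"
    by (auto simp: inj_mor_def)
  then have "surj_mor \<C> X K k" using inj_mor_dual_iff k'(1) by blast
  moreover have "A = Ann X (Ker X K k)"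
    using image_dual_map[OF Und_module Und_module mor_lin] k k'(2) by simp
  ultimately show "\<exists>K k. surj_mor \<C> X K k \<and> A = Ann X (Ker X K k)" by blast
next
  assume "\<exists>K k. surj_mor \<C> X K k \<and> A = Ann X (Ker X K k)"
  then obtain K k where k: "surj_mor \<C> X K k" "A = Ann X (Ker X K k)" by blast
  then have obj: "X \<in> Obj \<C>" "K \<in> Obj \<C>" "k \<in> Mor \<C> X K" by (simp_all add: surj_mor_def)
  have "inj_mor \<D> K X (dual X K k)" using inj_mor_dual_iff[OF obj] k(1) by blast
  moreover have "A = dual X K k ` elts \<D> K"
    using image_dual_map[OF Und_module[OF obj(1)] Und_module[OF obj(2)] mor_lin[OF obj]] k(2) by simp
  ultimately show "subobject \<D> X A" unfolding subobject_def by blast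
qed

text \<open>For a general set of forms, \<open>Ann\<close> of \<open>Coann\<close> may be larger
  than the set. Here \<open>A\<close> is the annihilator of a kernel, and \<open>coann_ann\<close>
  recovers that kernel.\<close>

lemma
  assumes "subobject \<D> X A"
  shows subobject_dual_Obj: "X \<in> Obj \<C>"
    and subobject_dual_forms: "A \<subseteq> forms X"
    and subobject_dual_submodule: "submodule A R (matlis_dual R E (Und \<C> X))"
    and Ann_Coann: "Ann X (Coann X A) = A"
proof -
  obtain K k where k: "surj_mor \<C> X K k" "A = Ann X (Ker X K k)"
    using assms subobject_dual_iff by blast
  then have obj: "X \<in> Obj \<C>" "K \<in> Obj \<C>" "k \<in> Mor \<C> X K" by (simp_all add: surj_mor_def)
  show "X \<in> Obj \<C>" by (rule obj(1))
  show "A \<subseteq> forms X" using k(2) ann_lin by blast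
  show "submodule A R (matlis_dual R E (Und \<C> X))"
    unfolding k(2) by (rule ann_submodule[OF Und_module[OF obj(1)] module_E]) blast
  show "Ann X (Coann X A) = A"
    unfolding k(2) coann_ann[OF Und_module[OF obj(1)] ker_submodule[OF obj]] ..
qed

lemma Coann_Ann: "X \<in> Obj \<C> \<Longrightarrow> submodule L R (Und \<C> X) \<Longrightarrow> Coann X (Ann X L) = L"
  by (rule coann_ann[OF Und_module])

lemma dual_pairs_iff:
  "(A, X) \<in> dual_pairs R E \<C> \<Q> \<longleftrightarrow> subobject \<D> X A \<and> (Coann X A, X) \<in> \<Q>"
  using dual_sub_eq[OF Und_module module_E subobject_dual_submodule] subobject_dual_Obj
  by (auto simp: dual_pairs_def)

lemma smile_Ann:
  assumes "subobject \<D> X A" "submodule (p (Coann X A) X) R (Und \<C> X)"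
  shows "smile R E \<C> p A X = Ann X (p (Coann X A) X)"
  using smile_eq[OF Und_module module_E subobject_dual_submodule] subobject_dual_Obj assms by blast

section \<open>Annihilators under images and preimages\<close>

lemma Coann_image_dual:
  assumes X: "X \<in> Obj \<C>" and Y: "Y \<in> Obj \<C>" and f: "f \<in> Mor \<C> Y X" and A: "A \<subseteq> forms X"
  shows "Coann Y (dual Y X f ` A) = pre \<C> Y f (Coann X A)"
proof -
  have "(\<forall>g\<in>dual Y X f ` A. g y = \<zero>\<^bsub>E\<^esub>) \<longleftrightarrow> (\<forall>g\<in>A. g (f y) = \<zero>\<^bsub>E\<^esub>)" if "y \<in> elts \<C> Y" for y
    using that A by (auto simp: dual_map_apply subset_iff)
  then show ?thesis
    using mor_closed[OF Y X f] by (auto simp: coann_def pre_def)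
qed

lemma pre_dual_Ann:
  assumes X: "X \<in> Obj \<C>" and Y: "Y \<in> Obj \<C>" and f: "f \<in> Mor \<C> Y X" and L: "L \<subseteq> elts \<C> Y"
  shows "pre \<D> X (dual Y X f) (Ann Y L) = Ann X (f ` L)"
proof -
  have "(\<forall>y\<in>L. dual Y X f g y = \<zero>\<^bsub>E\<^esub>) \<longleftrightarrow> (\<forall>y\<in>L. g (f y) = \<zero>\<^bsub>E\<^esub>)" if "g \<in> forms X" for g
    using that L by (auto simp: dual_map_apply subset_iff)
  then show ?thesis
    using dual_form[OF Y X f] by (auto simp: ann_def pre_def)
qed

end

section \<open>Duals of pair operations\<close>

text \<open>\<open>hereditary\<close> is a definite description: one presentation gives existence,
  and agreement of all presentations with \<open>q\<close> gives uniqueness.\<close>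

lemma hereditary_eq:
  assumes q: "is_hereditary_version \<C> \<P> \<P>' p q" and AB: "(A, B) \<in> \<P>'"
  shows "hereditary \<C> \<P> p A B = q A B"
proof -
  note v = bspec[OF q[unfolded is_hereditary_version_def] AB, unfolded prod.case]
  obtain E i where "injective_presentation \<C> \<P> A B E i" using v by (elim conjE exE)
  with v show ?thesis
    unfolding hereditary_def by (intro the_equality) metis+
qed

lemma cohereditary_eq:
  assumes q: "is_cohereditary_version \<C> \<P> \<P>' p q" and LX: "(L, X) \<in> \<P>'"
  shows "cohereditary \<C> \<P> p L X = q L X"
proof -
  note v = bspec[OF q[unfolded is_cohereditary_version_def] LX, unfolded prod.case]
  obtain P \<pi> where "projective_presentation \<C> \<P> L X P \<pi>" using v by (elim conjE exE)
  with v show ?thesis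
    unfolding cohereditary_def by (intro the_equality) metis+
qed

context dual_modcat
begin

text \<open>If \<open>A\<close> is the image of the dual of a surjection \<open>k\<close>, its image
  under the dual of \<open>f\<close> is the image of the dual of \<open>k\<close> after
  \<open>f\<close>, which is again surjective.\<close>

lemma subobject_dual_image:
  assumes A: "subobject \<D> X A" and f: "surj_mor \<C> Y X f"
  shows "subobject \<D> Y (dual Y X f ` A)"
proof -
  have obj: "Y \<in> Obj \<C>" "X \<in> Obj \<C>" "f \<in> Mor \<C> Y X" using f by (simp_all add: surj_mor_def)
  obtain K k where k: "surj_mor \<C> X K k" "A = Ann X (Ker X K k)"
    using A unfolding subobject_dual_iff by (elim exE conjE)
  have k': "K \<in> Obj \<C>" "k \<in> Mor \<C> X K" using k(1) by (simp_all add: surj_mor_def)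
  let ?h = "compose (elts \<C> Y) k f"
  have h: "?h \<in> Mor \<C> Y K" by (rule Mor_comp[OF obj(1,2) k'(1) obj(3) k'(2)])
  have "?h ` elts \<C> Y = k ` f ` elts \<C> Y"
    unfolding image_image by (rule image_cong) (simp_all add: compose_def)
  then have "surj_mor \<C> Y K ?h"
    unfolding surj_mor_def using f k(1) h obj(1) k'(1) by (simp only: surj_mor_def simp_thms)
  then have "inj_mor \<D> K Y (dual Y K ?h)" unfolding inj_mor_dual_iff[OF obj(1) k'(1) h] .
  moreover have "dual Y X f (dual X K k c) = dual Y K ?h c" if "c \<in> forms K" for c
    by (rule dual_comp_eq_iff[OF obj(1,2) k'(1) obj(3) k'(2) h, THEN iffD2, rule_format, OF _ that])
      (simp add: compose_def)
  then have "dual Y X f ` A = dual Y K ?h ` elts \<D> K"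
    unfolding k(2) image_dual_map[OF Und_module[OF obj(2)] Und_module[OF k'(1)] mor_lin[OF obj(2) k'], symmetric]
    unfolding image_image by (intro image_cong) simp_all
  ultimately show ?thesis unfolding subobject_def by (intro exI conjI)
qed

text \<open>The image under \<open>i\<close> of the kernel of \<open>k\<close> must again be the
  kernel of a surjection in \<C>. With \<open>n\<close> a kernel of \<open>k\<close> in \<C>, the
  cokernel of \<open>i\<close> after \<open>n\<close> is such a surjection.\<close>

lemma subobject_dual_Ann_image:
  assumes A: "subobject \<D> B A" and i: "inj_mor \<C> B F i"
  shows "subobject \<D> F (Ann F (i ` Coann B A))"
proof -
  have obj: "B \<in> Obj \<C>" "F \<in> Obj \<C>" "i \<in> Mor \<C> B F" using i by (simp_all add: inj_mor_def)
  obtain K k where k: "surj_mor \<C> B K k" "A = Ann B (Ker B K k)"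
    using A unfolding subobject_dual_iff by (elim exE conjE)
  have k': "K \<in> Obj \<C>" "k \<in> Mor \<C> B K" using k(1) by (simp_all add: surj_mor_def)
  have L: "Coann B A = Ker B K k"
    unfolding k(2) by (rule Coann_Ann[OF obj(1) ker_submodule[OF obj(1) k']])
  obtain N n where n: "is_kernel \<C> N n B K k" using kernels[OF obj(1) k'] by blast
  then have n': "N \<in> Obj \<C>" "n \<in> Mor \<C> N B" "n ` elts \<C> N = Ker B K k"
    unfolding is_kernel_def inj_mor_def by blast+
  let ?h = "compose (elts \<C> N) i n"
  have h: "?h \<in> Mor \<C> N F" by (rule Mor_comp[OF n'(1) obj(1,2) n'(2) obj(3)])
  obtain Q q where q: "is_cokernel \<C> Q q N F ?h" using cokernels[OF n'(1) obj(2) h] by blast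
  have "?h ` elts \<C> N = i ` n ` elts \<C> N"
    unfolding image_image by (rule image_cong) (simp_all add: compose_def)
  moreover have qs: "surj_mor \<C> F Q q" "Ker F Q q = ?h ` elts \<C> N"
    using q unfolding is_cokernel_def by blast+
  ultimately have "Ann F (i ` Coann B A) = Ann F (Ker F Q q)"
    using L n'(3) by simp
  then show ?thesis
    unfolding subobject_dual_iff by (intro exI) (rule conjI[OF qs(1)])
qed

text \<open>A form on \<open>B\<close> that vanishes on the preimage of \<open>S\<close> extends
  along \<open>i\<close> to a form that kills \<open>S\<close>; this is \<open>extend_along\<close>
  in full, with \<open>i\<close> not assumed injective.\<close>

lemma image_dual_Ann:
  assumes B: "B \<in> Obj \<C>" and F: "F \<in> Obj \<C>" and i: "i \<in> Mor \<C> B F"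
    and S: "submodule S R (Und \<C> F)"
  shows "dual B F i ` Ann F S = Ann B (pre \<C> B i S)"
proof
  show "dual B F i ` Ann F S \<subseteq> Ann B (pre \<C> B i S)"
  proof
    fix b assume "b \<in> dual B F i ` Ann F S"
    then obtain c where c: "c \<in> Ann F S" "b = dual B F i c" by blast
    then show "b \<in> Ann B (pre \<C> B i S)"
      using dual_form[OF B F i ann_lin[OF c(1)]]
      by (simp add: ann_def pre_def dual_map_apply)
  qed
  show "Ann B (pre \<C> B i S) \<subseteq> dual B F i ` Ann F S"
  proof
    fix b assume b: "b \<in> Ann B (pre \<C> B i S)"
    have "\<exists>c\<in>Ann F S. \<forall>x\<in>elts \<C> B. c (i x) = b x"
      by (rule extend_along[OF Und_module[OF B] Und_module[OF F] mor_lin[OF B F i] ann_lin[OF b] S])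
        (rule annD[OF b], simp add: pre_def)
    then obtain c where c: "c \<in> Ann F S" "\<forall>x\<in>elts \<C> B. c (i x) = b x" by blast
    have "b = dual B F i c"
      by (rule lin_eqI[OF ann_lin[OF b] dual_form[OF B F i ann_lin[OF c(1)]]])
        (simp add: c(2) dual_map_apply[OF ann_lin[OF c(1)]])
    then show "b \<in> dual B F i ` Ann F S" using c(1) by blast
  qed
qed

section \<open>Axioms inherited by the dual operation\<close>

lemma smile_pair:
  assumes "pair_operation R \<C> \<Q> p" "(A, X) \<in> dual_pairs R E \<C> \<Q>"
  shows "submodule (p (Coann X A) X) R (Und \<C> X)"
    and "smile R E \<C> p A X = Ann X (p (Coann X A) X)"
proof -
  show "submodule (p (Coann X A) X) R (Und \<C> X)"
    using assms unfolding dual_pairs_iff pair_operation_def by blast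
  then show "smile R E \<C> p A X = Ann X (p (Coann X A) X)"
    using assms(2) smile_Ann unfolding dual_pairs_iff by blast
qed

text \<open>The inverse of \<open>\<phi>\<close> is itself the dual of some \<open>g\<close>.
  Comparing the composites with identities of \<C> by \<open>dual_comp_eq_iff\<close> shows that
  \<open>f\<close> and \<open>g\<close> are mutually inverse.\<close>

lemma iso_mor_dual:
  assumes "iso_mor \<D> X Y \<phi>"
  obtains f g where "X \<in> Obj \<C>" "Y \<in> Obj \<C>" "f \<in> Mor \<C> Y X" "\<phi> = dual Y X f" "g \<in> Mor \<C> X Y"
    "\<forall>x\<in>elts \<C> X. f (g x) = x" "\<forall>y\<in>elts \<C> Y. g (f y) = y"
proof -
  have obj: "X \<in> Obj \<C>" "Y \<in> Obj \<C>" using assms by (simp_all add: iso_mor_def)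
  obtain f where f: "f \<in> Mor \<C> Y X" "\<phi> = dual Y X f"
    using assms by (auto simp: iso_mor_def)
  obtain g where g: "g \<in> Mor \<C> X Y" "\<forall>c\<in>forms X. dual X Y g (\<phi> c) = c" "\<forall>c\<in>forms Y. \<phi> (dual X Y g c) = c"
    using assms by (auto simp: iso_mor_def)
  have id: "dual Z Z (\<lambda>x\<in>elts \<C> Z. x) c = c" if "Z \<in> Obj \<C>" "c \<in> forms Z" for Z c
    by (rule lin_eqI[OF dual_form[OF that(1,1) Mor_id[OF that(1)] that(2)] that(2)])
      (simp add: dual_map_apply[OF that(2)])
  have "\<forall>x\<in>elts \<C> X. f (g x) = (\<lambda>x\<in>elts \<C> X. x) x"
    using dual_comp_eq_iff[OF obj(1,2,1) g(1) f(1) Mor_id[OF obj(1)]] g(2) f(2) id[OF obj(1)] by simp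
  moreover have "\<forall>y\<in>elts \<C> Y. g (f y) = (\<lambda>y\<in>elts \<C> Y. y) y"
    using dual_comp_eq_iff[OF obj(2,1,2) f(1) g(1) Mor_id[OF obj(2)]] g(3) f(2) id[OF obj(2)] by simp
  ultimately show thesis
    by (intro that[OF obj f g(1)]) simp_all
qed

lemma pair_operation_smile:
  assumes cl: "pair_class \<C> \<Q>" and p: "pair_operation R \<C> \<Q> p"
  shows "pair_operation R \<D> (dual_pairs R E \<C> \<Q>) (smile R E \<C> p)"
  unfolding pair_operation_def
proof (clarify, intro conjI allI impI)
  fix A X assume AX: "(A, X) \<in> dual_pairs R E \<C> \<Q>"
  have A: "subobject \<D> X A" and L: "(Coann X A, X) \<in> \<Q>" using AX dual_pairs_iff by blast+
  have X: "X \<in> Obj \<C>" by (rule subobject_dual_Obj[OF A])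
  let ?L = "Coann X A" and ?S = "p (Coann X A) X"
  have S: "submodule ?S R (Und \<C> X)" by (rule smile_pair(1)[OF p AX])
  have Ssub: "?S \<subseteq> elts \<C> X" by (rule module.submoduleE(1)[OF Und_module[OF X] S])
  show "submodule (smile R E \<C> p A X) R (Und \<D> X)"
    using ann_submodule[OF Und_module[OF X] module_E Ssub] smile_pair(2)[OF p AX] by simp
  fix Y \<phi> assume "iso_mor \<D> X Y \<phi>"
  then obtain f g where Y: "Y \<in> Obj \<C>" and f: "f \<in> Mor \<C> Y X" "\<phi> = dual Y X f" and g: "g \<in> Mor \<C> X Y"
    and fg: "\<forall>x\<in>elts \<C> X. f (g x) = x" and gf: "\<forall>y\<in>elts \<C> Y. g (f y) = y"
    by (rule iso_mor_dual)
  \<comment> \<open>\<open>f\<close> runs from \<open>Y\<close> to \<open>X\<close>, against the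
    direction of \<open>\<phi>\<close>; its inverse \<open>g\<close> is what carries pairs on
    \<open>X\<close> to pairs on \<open>Y\<close>.\<close>
  have iso: "iso_mor \<C> X Y g"
    unfolding iso_mor_def using X Y f(1) g fg gf by blast
  have "f ` elts \<C> Y = elts \<C> X"
    using mor_closed[OF Y X f(1)] mor_closed[OF X Y g] fg by (force simp: image_iff)
  then have surj: "surj_mor \<C> Y X f" using X Y f(1) by (simp add: surj_mor_def)
  have pre: "pre \<C> Y f T = g ` T" if "T \<subseteq> elts \<C> X" for T
  proof
    show "pre \<C> Y f T \<subseteq> g ` T" using gf by (force simp: pre_def)
    show "g ` T \<subseteq> pre \<C> Y f T" using that fg mor_closed[OF X Y g] by (auto simp: pre_def subset_iff)
  qed
  have Lsub: "?L \<subseteq> elts \<C> X" by (auto simp: coann_def)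
  have co: "Coann Y (\<phi> ` A) = g ` ?L"
    unfolding f(2) Coann_image_dual[OF X Y f(1) subobject_dual_forms[OF A]] by (rule pre[OF Lsub])
  have "(g ` ?L, Y) \<in> \<Q>" using cl L iso unfolding pair_class_def by blast
  then have AY: "(\<phi> ` A, Y) \<in> dual_pairs R E \<C> \<Q>"
    unfolding dual_pairs_iff co using subobject_dual_image[OF A surj] f(2) by simp
  have "g ` ?S = p (g ` ?L) Y" using p L iso unfolding pair_operation_def by blast
  then have "smile R E \<C> p (\<phi> ` A) Y = Ann Y (pre \<C> Y f ?S)"
    using smile_pair(2)[OF p AY] co pre[OF Ssub] by simp
  then show "\<phi> ` smile R E \<C> p A X = smile R E \<C> p (\<phi> ` A) Y"
    using image_dual_Ann[OF Y X f(1) S] smile_pair(2)[OF p AX] f(2) by simp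
qed

text \<open>The image of \<open>A\<close> under a dual map corresponds to the preimage of
  \<open>Coann X A\<close>, so cofunctoriality of \<open>p\<close> is the matching condition.
  Annihilators reverse its inclusion, and \<open>image_dual_Ann\<close> turns the preimage back into
  an image.\<close>

lemma functorial_smile:
  assumes p: "pair_operation R \<C> \<Q> p" and cof: "cofunctorial \<C> \<Q> p"
  shows "functorial \<D> (dual_pairs R E \<C> \<Q>) (smile R E \<C> p)"
  unfolding functorial_def
proof (intro ballI allI impI, elim conjE)
  fix X Y h A
  assume obj: "X \<in> Obj \<D>" "Y \<in> Obj \<D>" and h: "h \<in> Mor \<D> X Y"
    and AX: "(A, X) \<in> dual_pairs R E \<C> \<Q>" and AY: "(h ` A, Y) \<in> dual_pairs R E \<C> \<Q>"
  have X: "X \<in> Obj \<C>" and Y: "Y \<in> Obj \<C>" using obj by simp_all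
  obtain f where f: "f \<in> Mor \<C> Y X" "h = dual Y X f" using h by auto
  have A: "subobject \<D> X A" and L: "(Coann X A, X) \<in> \<Q>" using AX dual_pairs_iff by blast+
  have co: "Coann Y (h ` A) = pre \<C> Y f (Coann X A)"
    unfolding f(2) by (rule Coann_image_dual[OF X Y f(1) subobject_dual_forms[OF A]])
  have "(pre \<C> Y f (Coann X A), Y) \<in> \<Q>" using AY unfolding dual_pairs_iff co by blast
  then have "p (pre \<C> Y f (Coann X A)) Y \<subseteq> pre \<C> Y f (p (Coann X A) X)"
    using cof X Y f(1) L unfolding cofunctorial_def by blast
  then have "Ann Y (pre \<C> Y f (p (Coann X A) X)) \<subseteq> smile R E \<C> p (h ` A) Y"
    unfolding smile_pair(2)[OF p AY] co by (rule ann_anti)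
  then show "h ` smile R E \<C> p A X \<subseteq> smile R E \<C> p (h ` A) Y"
    using image_dual_Ann[OF Y X f(1) smile_pair(1)[OF p AX]] smile_pair(2)[OF p AX] f(2) by simp
qed

lemma Coann_pre_dual:
  assumes A: "subobject \<D> B A" and F: "F \<in> Obj \<C>" and i: "i \<in> Mor \<C> B F"
  shows "pre \<D> F (dual B F i) A = Ann F (i ` Coann B A)"
    and "Coann F (pre \<D> F (dual B F i) A) = i ` Coann B A"
proof -
  have B: "B \<in> Obj \<C>" by (rule subobject_dual_Obj[OF A])
  have "Coann B A \<subseteq> elts \<C> B" by (auto simp: coann_def)
  then show pre: "pre \<D> F (dual B F i) A = Ann F (i ` Coann B A)"
    using pre_dual_Ann[OF F B i] Ann_Coann[OF A] by metis
  have "submodule (i ` Coann B A) R (Und \<C> F)"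
    by (rule submodule_image[OF Und_module[OF B] Und_module[OF F] mor_lin[OF B F i]
          coann_submodule[OF Und_module[OF B] module_E subobject_dual_forms[OF A]]])
  then show "Coann F (pre \<D> F (dual B F i) A) = i ` Coann B A"
    unfolding pre by (rule Coann_Ann[OF F])
qed

lemma cofunctorial_smile:
  assumes p: "pair_operation R \<C> \<Q> p" and fu: "functorial \<C> \<Q> p"
  shows "cofunctorial \<D> (dual_pairs R E \<C> \<Q>) (smile R E \<C> p)"
  unfolding cofunctorial_def
proof (intro ballI allI impI, elim conjE)
  fix X Y h A
  assume obj: "X \<in> Obj \<D>" "Y \<in> Obj \<D>" and h: "h \<in> Mor \<D> X Y"
    and AX: "(pre \<D> X h A, X) \<in> dual_pairs R E \<C> \<Q>" and AY: "(A, Y) \<in> dual_pairs R E \<C> \<Q>"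
  have X: "X \<in> Obj \<C>" and Y: "Y \<in> Obj \<C>" using obj by simp_all
  obtain f where f: "f \<in> Mor \<C> Y X" "h = dual Y X f" using h by auto
  have A: "subobject \<D> Y A" and L: "(Coann Y A, Y) \<in> \<Q>" using AY dual_pairs_iff by blast+
  let ?S = "p (Coann Y A) Y"
  have co: "Coann X (pre \<D> X h A) = f ` Coann Y A"
    unfolding f(2) by (rule Coann_pre_dual(2)[OF A X f(1)])
  have "(f ` Coann Y A, X) \<in> \<Q>" using AX unfolding dual_pairs_iff co by blast
  then have "f ` ?S \<subseteq> p (f ` Coann Y A) X"
    using fu X Y f(1) L unfolding functorial_def by blast
  then have "smile R E \<C> p (pre \<D> X h A) X \<subseteq> Ann X (f ` ?S)"
    unfolding smile_pair(2)[OF p AX] co by (rule ann_anti)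
  moreover have "?S \<subseteq> elts \<C> Y"
    by (rule module.submoduleE(1)[OF Und_module[OF Y] smile_pair(1)[OF p AY]])
  ultimately show "smile R E \<C> p (pre \<D> X h A) X \<subseteq> pre \<D> X h (smile R E \<C> p A Y)"
    unfolding smile_pair(2)[OF p AY] f(2) using pre_dual_Ann[OF X Y f(1)] by simp
qed

lemma order_preserving_smile:
  assumes p: "pair_operation R \<C> \<Q> p" and mono: "order_preserving \<Q> p"
  shows "order_preserving (dual_pairs R E \<C> \<Q>) (smile R E \<C> p)"
  unfolding order_preserving_def
proof (intro allI impI, elim conjE)
  fix A B X assume A: "(A, X) \<in> dual_pairs R E \<C> \<Q>" and B: "(B, X) \<in> dual_pairs R E \<C> \<Q>" and "A \<subseteq> B"
  then have "Coann X B \<subseteq> Coann X A" by (intro coann_anti)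
  then have "p (Coann X B) X \<subseteq> p (Coann X A) X"
    using mono A B unfolding order_preserving_def dual_pairs_iff by blast
  then show "smile R E \<C> p A X \<subseteq> smile R E \<C> p B X"
    unfolding smile_pair(2)[OF p A] smile_pair(2)[OF p B] by (rule ann_anti)
qed

text \<open>\<open>Coann\<close> undoes the annihilator in the value of \<open>smile\<close>, so
  applying \<open>smile\<close> twice applies \<open>p\<close> twice, and the iterate is defined for
  \<open>p\<close> whenever it is for \<open>smile\<close>.\<close>

lemma idempotent_smile:
  assumes p: "pair_operation R \<C> \<Q> p" and idem: "idempotent \<Q> p"
  shows "idempotent (dual_pairs R E \<C> \<Q>) (smile R E \<C> p)"
  unfolding idempotent_def
proof (intro allI impI, elim conjE)
  fix A X assume A: "(A, X) \<in> dual_pairs R E \<C> \<Q>" and sA: "(smile R E \<C> p A X, X) \<in> dual_pairs R E \<C> \<Q>"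
  have X: "X \<in> Obj \<C>" using A by (simp add: dual_pairs_def)
  have co: "Coann X (smile R E \<C> p A X) = p (Coann X A) X"
    unfolding smile_pair(2)[OF p A] by (rule Coann_Ann[OF X smile_pair(1)[OF p A]])
  have "p (p (Coann X A) X) X = p (Coann X A) X"
    using idem A sA unfolding idempotent_def dual_pairs_iff co by blast
  then show "smile R E \<C> p (smile R E \<C> p A X) X = smile R E \<C> p A X"
    unfolding smile_pair(2)[OF p sA] smile_pair(2)[OF p A, symmetric] co
    by (simp add: smile_pair(2)[OF p A])
qed

text \<open>Taking annihilators of \<open>L \<subseteq> p L X\<close> at
  \<open>L = Coann X A\<close> reverses the inclusion, and \<open>Ann_Coann\<close> identifies the
  larger side with \<open>A\<close>.\<close>

lemma interior_operation_smile:
  assumes cl: "pair_class \<C> \<Q>" and p: "closure_operation R \<C> \<Q> p"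
  shows "interior_operation R \<D> (dual_pairs R E \<C> \<Q>) (smile R E \<C> p)"
proof -
  have p': "pair_operation R \<C> \<Q> p" "order_preserving \<Q> p" "idempotent \<Q> p"
    and ext: "\<And>L X. (L, X) \<in> \<Q> \<Longrightarrow> L \<subseteq> p L X"
    using p unfolding closure_operation_def by blast+
  have "smile R E \<C> p A X \<subseteq> A" if A: "(A, X) \<in> dual_pairs R E \<C> \<Q>" for A X
    using ann_anti[OF ext, of "Coann X A" X R E "Und \<C> X"] A Ann_Coann[of X A]
    unfolding smile_pair(2)[OF p'(1) A] dual_pairs_iff by blast
  then show ?thesis
    using pair_operation_smile[OF cl p'(1)] order_preserving_smile[OF p'(1,2)] idempotent_smile[OF p'(1,3)]
    unfolding interior_operation_def by blast
qed

lemma closure_operation_smile: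
  assumes cl: "pair_class \<C> \<Q>" and p: "interior_operation R \<C> \<Q> p"
  shows "closure_operation R \<D> (dual_pairs R E \<C> \<Q>) (smile R E \<C> p)"
proof -
  have p': "pair_operation R \<C> \<Q> p" "order_preserving \<Q> p" "idempotent \<Q> p"
    and int: "\<And>L X. (L, X) \<in> \<Q> \<Longrightarrow> p L X \<subseteq> L"
    using p unfolding interior_operation_def by blast+
  have "A \<subseteq> smile R E \<C> p A X" if A: "(A, X) \<in> dual_pairs R E \<C> \<Q>" for A X
    using ann_anti[OF int, of "Coann X A" X R E "Und \<C> X"] A Ann_Coann[of X A]
    unfolding smile_pair(2)[OF p'(1) A] dual_pairs_iff by blast
  then show ?thesis
    using pair_operation_smile[OF cl p'(1)] order_preserving_smile[OF p'(1,2)] idempotent_smile[OF p'(1,3)]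
    unfolding closure_operation_def by blast
qed

section \<open>Presentations and versions under duality\<close>

lemma injective_presentation_dual_iff:
  assumes A: "subobject \<D> B A" and P: "P \<in> Obj \<C>" and \<pi>: "\<pi> \<in> Mor \<C> P B"
  shows "injective_presentation \<D> (dual_pairs R E \<C> \<P>) A B P (dual P B \<pi>) \<longleftrightarrow>
    projective_presentation \<C> \<P> (Coann B A) B P \<pi>"
  unfolding injective_presentation_def projective_presentation_def injective_obj_dual_iff dual_pairs_iff
    inj_mor_dual_iff[OF P subobject_dual_Obj[OF A] \<pi>]
    Coann_image_dual[OF subobject_dual_Obj[OF A] P \<pi> subobject_dual_forms[OF A]]
  using subobject_dual_image[OF A] by blast

text \<open>Beyond translating each clause, the pair on \<open>F\<close> must be a subobject of the
  dual category. Injectivity of \<open>i\<close> yields this through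
  \<open>subobject_dual_Ann_image\<close>, just as surjectivity did through
  \<open>subobject_dual_image\<close> in the other direction.\<close>

lemma projective_presentation_dual_iff:
  assumes A: "subobject \<D> B A" and F: "F \<in> Obj \<C>" and i: "i \<in> Mor \<C> B F"
  shows "projective_presentation \<D> (dual_pairs R E \<C> \<P>) A B F (dual B F i) \<longleftrightarrow>
    injective_presentation \<C> \<P> (Coann B A) B F i"
  unfolding injective_presentation_def projective_presentation_def projective_obj_dual_iff dual_pairs_iff
    surj_mor_dual_iff[OF subobject_dual_Obj[OF A] F i] Coann_pre_dual[OF A F i]
  using subobject_dual_Ann_image[OF A] Coann_pre_dual[OF A F i] by auto

text \<open>Any injective presentation in the dual category is the dual of a projective one, at
  which \<open>q\<close> is known; \<open>pre_dual_Ann\<close> then matches the two values.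
  Independence of the presentation is thus inherited from \<C>.\<close>

lemma hereditary_version_smile:
  assumes p: "pair_operation R \<C> \<P> p" and q: "is_cohereditary_version \<C> \<P> \<P>' p q"
  shows "is_hereditary_version \<D> (dual_pairs R E \<C> \<P>) (dual_pairs R E \<C> \<P>')
    (smile R E \<C> p) (smile R E \<C> q)"
  unfolding is_hereditary_version_def
proof (clarify, intro conjI allI impI)
  fix A B assume AB: "(A, B) \<in> dual_pairs R E \<C> \<P>'"
  then have A: "subobject \<D> B A" and L: "(Coann B A, B) \<in> \<P>'" using dual_pairs_iff by blast+
  have B: "B \<in> Obj \<C>" by (rule subobject_dual_Obj[OF A])
  obtain P \<pi> where P\<pi>: "projective_presentation \<C> \<P> (Coann B A) B P \<pi>"
    using q L unfolding is_cohereditary_version_def by blast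
  then have "P \<in> Obj \<C>" "\<pi> \<in> Mor \<C> P B" by (simp_all add: projective_presentation_def surj_mor_def)
  then show "\<exists>P i. injective_presentation \<D> (dual_pairs R E \<C> \<P>) A B P i"
    using injective_presentation_dual_iff[OF A] P\<pi> by blast
  fix P i assume Pi: "injective_presentation \<D> (dual_pairs R E \<C> \<P>) A B P i"
  then have P: "P \<in> Obj \<C>" and "i \<in> Mor \<D> B P" and iA: "(i ` A, P) \<in> dual_pairs R E \<C> \<P>"
    by (simp_all add: injective_presentation_def inj_mor_def)
  then obtain \<pi> where \<pi>: "\<pi> \<in> Mor \<C> P B" "i = dual P B \<pi>" by auto
  let ?S = "p (pre \<C> P \<pi> (Coann B A)) P"
  have co: "Coann P (i ` A) = pre \<C> P \<pi> (Coann B A)"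
    unfolding \<pi>(2) by (rule Coann_image_dual[OF B P \<pi>(1) subobject_dual_forms[OF A]])
  have S: "submodule ?S R (Und \<C> P)" and sS: "smile R E \<C> p (i ` A) P = Ann P ?S"
    using smile_pair[OF p iA] unfolding co by blast+
  have "projective_presentation \<C> \<P> (Coann B A) B P \<pi>"
    using Pi injective_presentation_dual_iff[OF A P \<pi>(1)] \<pi>(2) by simp
  then have q': "q (Coann B A) B = \<pi> ` ?S"
    using q L unfolding is_cohereditary_version_def by blast
  \<comment> \<open>\<open>q\<close> is not assumed to be a pair operation; that its value is a
    submodule, as \<open>smile_Ann\<close> requires, is read off from the presentation.\<close>
  have "submodule (\<pi> ` ?S) R (Und \<C> B)"
    by (rule submodule_image[OF Und_module[OF P] Und_module[OF B] mor_lin[OF P B \<pi>(1)] S])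
  then have "smile R E \<C> q A B = Ann B (\<pi> ` ?S)"
    using smile_Ann[OF A, of q] q' by simp
  also have "\<dots> = pre \<D> B i (Ann P ?S)"
    unfolding \<pi>(2)
    by (rule pre_dual_Ann[OF B P \<pi>(1) module.submoduleE(1)[OF Und_module[OF P] S], symmetric])
  finally show "smile R E \<C> q A B = pre \<D> B i (smile R E \<C> p (i ` A) P)"
    unfolding sS .
qed

text \<open>Here the values are matched by \<open>image_dual_Ann\<close>, so forms on
  \<open>B\<close> have to be extended to \<open>F\<close>: injectivity of \<open>E\<close> enters
  directly.\<close>

lemma cohereditary_version_smile:
  assumes p: "pair_operation R \<C> \<P> p" and q: "is_hereditary_version \<C> \<P> \<P>' p q"
  shows "is_cohereditary_version \<D> (dual_pairs R E \<C> \<P>) (dual_pairs R E \<C> \<P>')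
    (smile R E \<C> p) (smile R E \<C> q)"
  unfolding is_cohereditary_version_def
proof (clarify, intro conjI allI impI)
  fix A B assume AB: "(A, B) \<in> dual_pairs R E \<C> \<P>'"
  then have A: "subobject \<D> B A" and L: "(Coann B A, B) \<in> \<P>'" using dual_pairs_iff by blast+
  have B: "B \<in> Obj \<C>" by (rule subobject_dual_Obj[OF A])
  obtain F i where Fi: "injective_presentation \<C> \<P> (Coann B A) B F i"
    using q L unfolding is_hereditary_version_def by blast
  then have "F \<in> Obj \<C>" "i \<in> Mor \<C> B F" by (simp_all add: injective_presentation_def inj_mor_def)
  then show "\<exists>F \<pi>. projective_presentation \<D> (dual_pairs R E \<C> \<P>) A B F \<pi>"
    using projective_presentation_dual_iff[OF A] Fi by blast
  fix F \<pi> assume F\<pi>: "projective_presentation \<D> (dual_pairs R E \<C> \<P>) A B F \<pi>"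
  then have F: "F \<in> Obj \<C>" and "\<pi> \<in> Mor \<D> F B" and pA: "(pre \<D> F \<pi> A, F) \<in> dual_pairs R E \<C> \<P>"
    by (simp_all add: projective_presentation_def surj_mor_def)
  then obtain i where i: "i \<in> Mor \<C> B F" "\<pi> = dual B F i" by auto
  let ?S = "p (i ` Coann B A) F"
  have co: "Coann F (pre \<D> F \<pi> A) = i ` Coann B A"
    unfolding i(2) by (rule Coann_pre_dual(2)[OF A F i(1)])
  have S: "submodule ?S R (Und \<C> F)" and sS: "smile R E \<C> p (pre \<D> F \<pi> A) F = Ann F ?S"
    using smile_pair[OF p pA] unfolding co by blast+
  have "injective_presentation \<C> \<P> (Coann B A) B F i"
    using F\<pi> projective_presentation_dual_iff[OF A F i(1)] i(2) by simp
  then have q': "q (Coann B A) B = pre \<C> B i ?S"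
    using q L unfolding is_hereditary_version_def by blast
  have "submodule (pre \<C> B i ?S) R (Und \<C> B)"
    unfolding pre_def
    by (rule submodule_pre[OF Und_module[OF B] Und_module[OF F] mor_lin[OF B F i(1)] S])
  then have "smile R E \<C> q A B = Ann B (pre \<C> B i ?S)"
    using smile_Ann[OF A, of q] q' by simp
  also have "\<dots> = \<pi> ` Ann F ?S"
    unfolding i(2) by (rule image_dual_Ann[OF B F i(1) S, symmetric])
  finally show "smile R E \<C> q A B = \<pi> ` smile R E \<C> p (pre \<D> F \<pi> A) F"
    unfolding sS .
qed

end

theorem proposition6p3:
  fixes R :: "('a, 'r) ring_scheme" and \<mm> :: "'a set" and E :: "('a, 'e) module"
    and \<C> :: "('a, 'b, 'o) modcat" and \<P> \<P>' :: "('b set \<times> 'o) set"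
  assumes R: "complete_local_ring R \<mm>"
    and E: "injective_hull R (residue_field R \<mm>) E"
  shows
    "let \<D> = dual_cat R E \<C>; \<P>d = dual_pairs R E \<C> \<P>; \<P>d' = dual_pairs R E \<C> \<P>' in
     (projective_setting R \<C> \<P> \<P>' \<and> (\<forall>M\<in>Obj \<C>. finitely_generated_module R (Und \<C> M)) \<longrightarrow>
       (\<forall>p. pair_operation R \<C> \<P> p \<and> cofunctorial \<C> \<P> p \<longrightarrow>
          pair_operation R \<D> \<P>d (smile R E \<C> p) \<and> functorial \<D> \<P>d (smile R E \<C> p) \<and>
          (\<forall>(A, B)\<in>\<P>d'. smile R E \<C> (cohereditary \<C> \<P> p) A B =
             hereditary \<D> \<P>d (smile R E \<C> p) A B) \<and>
          is_hereditary_version \<D> \<P>d \<P>d' (smile R E \<C> p) (smile R E \<C> (cohereditary \<C> \<P> p))) \<and>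
       (\<forall>cl. closure_operation R \<C> \<P> cl \<and> cofunctorial \<C> \<P> cl \<longrightarrow>
          interior_operation R \<D> \<P>d (smile R E \<C> cl) \<and>
          (\<forall>(A, B)\<in>\<P>d'. smile R E \<C> (residual \<C> \<P> cl) A B =
             absolute \<D> \<P>d (smile R E \<C> cl) A B))) \<and>
     (injective_setting R \<C> \<P> \<P>' \<and> (\<forall>M\<in>Obj \<C>. artinian_module R (Und \<C> M)) \<longrightarrow>
       (\<forall>p. pair_operation R \<C> \<P> p \<and> functorial \<C> \<P> p \<longrightarrow>
          pair_operation R \<D> \<P>d (smile R E \<C> p) \<and> cofunctorial \<D> \<P>d (smile R E \<C> p) \<and>
          (\<forall>(A, B)\<in>\<P>d'. smile R E \<C> (hereditary \<C> \<P> p) A B =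
             cohereditary \<D> \<P>d (smile R E \<C> p) A B) \<and>
          is_cohereditary_version \<D> \<P>d \<P>d' (smile R E \<C> p) (smile R E \<C> (hereditary \<C> \<P> p))) \<and>
       (\<forall>i. interior_operation R \<C> \<P> i \<and> functorial \<C> \<P> i \<longrightarrow>
          closure_operation R \<D> \<P>d (smile R E \<C> i) \<and>
          (\<forall>(A, B)\<in>\<P>d'. smile R E \<C> (absolute \<C> \<P> i) A B =
             residual \<D> \<P>d (smile R E \<C> i) A B)))"
proof -
  interpret injective_cogenerator R E by (rule injective_cogenerator_hull[OF R E])
  let ?\<D> = "dual_cat R E \<C>" and ?\<P> = "dual_pairs R E \<C> \<P>" and ?\<P>' = "dual_pairs R E \<C> \<P>'"
  have proj: "pair_operation R ?\<D> ?\<P> (smile R E \<C> p)" "functorial ?\<D> ?\<P> (smile R E \<C> p)"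
    "is_hereditary_version ?\<D> ?\<P> ?\<P>' (smile R E \<C> p) (smile R E \<C> (cohereditary \<C> \<P> p))"
    "\<forall>(A, B)\<in>?\<P>'. smile R E \<C> (cohereditary \<C> \<P> p) A B = hereditary ?\<D> ?\<P> (smile R E \<C> p) A B"
    if set: "projective_setting R \<C> \<P> \<P>'" and p: "pair_operation R \<C> \<P> p" "cofunctorial \<C> \<P> p" for p
  proof -
    interpret S: projective_setting R \<C> \<P> \<P>' by (rule set)
    interpret dual_modcat R \<C> E by unfold_locales
    show "pair_operation R ?\<D> ?\<P> (smile R E \<C> p)" by (rule pair_operation_smile[OF S.classes(1) p(1)])
    show "functorial ?\<D> ?\<P> (smile R E \<C> p)" by (rule functorial_smile[OF p])
    show v: "is_hereditary_version ?\<D> ?\<P> ?\<P>' (smile R E \<C> p) (smile R E \<C> (cohereditary \<C> \<P> p))"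
      by (rule hereditary_version_smile[OF p(1) S.cohereditary_version[OF p]])
    show "\<forall>(A, B)\<in>?\<P>'. smile R E \<C> (cohereditary \<C> \<P> p) A B = hereditary ?\<D> ?\<P> (smile R E \<C> p) A B"
      using hereditary_eq[OF v] by auto
  qed
  have inj: "pair_operation R ?\<D> ?\<P> (smile R E \<C> p)" "cofunctorial ?\<D> ?\<P> (smile R E \<C> p)"
    "is_cohereditary_version ?\<D> ?\<P> ?\<P>' (smile R E \<C> p) (smile R E \<C> (hereditary \<C> \<P> p))"
    "\<forall>(A, B)\<in>?\<P>'. smile R E \<C> (hereditary \<C> \<P> p) A B = cohereditary ?\<D> ?\<P> (smile R E \<C> p) A B"
    if set: "injective_setting R \<C> \<P> \<P>'" and p: "pair_operation R \<C> \<P> p" "functorial \<C> \<P> p" for p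
  proof -
    interpret S: injective_setting R \<C> \<P> \<P>' by (rule set)
    interpret dual_modcat R \<C> E by unfold_locales
    show "pair_operation R ?\<D> ?\<P> (smile R E \<C> p)" by (rule pair_operation_smile[OF S.classes(1) p(1)])
    show "cofunctorial ?\<D> ?\<P> (smile R E \<C> p)" by (rule cofunctorial_smile[OF p])
    show v: "is_cohereditary_version ?\<D> ?\<P> ?\<P>' (smile R E \<C> p) (smile R E \<C> (hereditary \<C> \<P> p))"
      by (rule cohereditary_version_smile[OF p(1) S.hereditary_version[OF p(2)]])
    show "\<forall>(A, B)\<in>?\<P>'. smile R E \<C> (hereditary \<C> \<P> p) A B = cohereditary ?\<D> ?\<P> (smile R E \<C> p) A B"
      using cohereditary_eq[OF v] by auto
  qed
  have int: "interior_operation R ?\<D> ?\<P> (smile R E \<C> cl)"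
    if set: "projective_setting R \<C> \<P> \<P>'" and cl: "closure_operation R \<C> \<P> cl" for cl
  proof -
    interpret S: projective_setting R \<C> \<P> \<P>' by (rule set)
    interpret dual_modcat R \<C> E by unfold_locales
    show ?thesis by (rule interior_operation_smile[OF S.classes(1) cl])
  qed
  have clo: "closure_operation R ?\<D> ?\<P> (smile R E \<C> i)"
    if set: "injective_setting R \<C> \<P> \<P>'" and i: "interior_operation R \<C> \<P> i" for i
  proof -
    interpret S: injective_setting R \<C> \<P> \<P>' by (rule set)
    interpret dual_modcat R \<C> E by unfold_locales
    show ?thesis by (rule closure_operation_smile[OF S.classes(1) i])
  qed
  have pair: "pair_operation R \<C> \<P> q" if "closure_operation R \<C> \<P> q \<or> interior_operation R \<C> \<P> q" for q
    using that by (auto simp: closure_operation_def interior_operation_def)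
  show ?thesis
    unfolding Let_def
    by (intro conjI allI impI; elim conjE)
      (rule proj inj int clo; (assumption | rule pair; simp))+
qed

end
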